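(* Let $\langle\cdot,\cdot\rangle$ be an inner product on $\mathbb{C}^d$ with induced norm $\|\cdot\|$. Consider $y'=Ly+g(t)$, $y(t_0)=y_0$, $t\in[t_0,t_f]$, and assume that $L\in\mathbb{C}^{d\times d}$ satisfies $$\forall y\in\mathbb{C}^d:\quad \mathrm{Re}\,\langle y,Ly\rangle\le\mu\|y\|^2,\qquad \mu\le0.$$ Suppose the GARK scheme with coefficients $\mathbf{A}^{\{1,1\}},\mathbf{A}^{\{1,2\}},\mathbf{b}^{\{1\}},\mathbf{b}^{\{2\}},\mathbf{c}^{\{2\}}$ (defined in the context) has an A-stable base method and satisfies (a) $w_{k,\ell}=0$ for $k=0,\dots,p$ and $\ell=0,\dots,s^{\{1\}}+1$; (b) $\widetilde W_{p+1}(z)$ is uniformly bounded over $\{z\in\mathbb{C}:\mathrm{Re}(z)\le\mu\}$. Then there exists a positive constant $C$, depending only on $\mu$, the timespan, and the method coefficients, such that for $t_f=t_0+nh$ fixed the global error $e_n=y(t_n)-y_n$ is bounded by $$\|e_n\|\le C\,\max_{t\in T}\|y^{(p+1)}(t)\|\,h^p,$$ where $$T=\left[t_0+\min\left(0,c^{\{2\}}_1,\dots,c^{\{2\}}_{s^{\{2\}}}\right)h,\ t_f+\max\left(0,c^{\{2\}}_1-1,\dots,c^{\{2\}}_{s^{\{2\}}}-1\right)h\right].$$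
   Context: The forcing $g$ is assumed at least $p$ times differentiable (so the exact solution $y(t)\in\mathbb{C}^d$ is $p+1$ times differentiable); $g$ and $y$ are considered on the possibly enlarged interval $T$. Method: $s^{\{1\}},s^{\{2\}}$ are positive integers, $\mathbf{A}^{\{1,1\}}\in\mathbb{R}^{s^{\{1\}}\times s^{\{1\}}}$, $\mathbf{A}^{\{1,2\}}\in\mathbb{R}^{s^{\{1\}}\times s^{\{2\}}}$, $\mathbf{b}^{\{1\}}\in\mathbb{R}^{s^{\{1\}}}$, $\mathbf{b}^{\{2\}},\mathbf{c}^{\{2\}}\in\mathbb{R}^{s^{\{2\}}}$. With constant step $h>0$, $t_n=t_0+nh$, and $y_0$ the exact initial value, each step is $$Y_i=y_n+h\sum_{j=1}^{s^{\{1\}}}a^{\{1,1\}}_{i,j}LY_j+h\sum_{j=1}^{s^{\{2\}}}a^{\{1,2\}}_{i,j}\,g(t_n+c^{\{2\}}_jh),\quad i=1,\dots,s^{\{1\}},$$ $$y_{n+1}=y_n+h\sum_{j=1}^{s^{\{1\}}}b^{\{1\}}_jLY_j+h\sum_{j=1}^{s^{\{2\}}}b^{\{2\}}_j\,g(t_n+c^{\{2\}}_jh),$$ where the linear stage system is taken to be uniquely solvable, i.e. $\mathbf{I}-\mathbf{A}^{\{1,1\}}\otimes hL$ is invertible. The base method is the Runge--Kutta method with coefficients $(\mathbf{A}^{\{1,1\}},\mathbf{b}^{\{1\}})$; its stability function is $R^{\{1\}}(z)=1+z\,\mathbf{b}^{\{1\}T}(\mathbf{I}_{s^{\{1\}}\times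 s^{\{1\}}}-z\mathbf{A}^{\{1,1\}})^{-1}\mathbf{1}_{s^{\{1\}}}$, and it is A-stable if $|R^{\{1\}}(z)|\le1$ whenever $\mathrm{Re}(z)\le0$. Let $\mathbf{C}^{\{2\}}=\mathrm{diag}(c^{\{2\}}_1,\dots,c^{\{2\}}_{s^{\{2\}}})$, $\mathbf{1}_s$ the all-ones vector of length $s$, $\mathbf{I}_{s\times s}$ the identity, and $\mathbf{v}^{\times k}$ the element-wise $k$-th power of a vector (zeroth powers being $\mathbf{1}$). For $k\ge1$ define the row vector of rational functions $$\widetilde W_k(z)=\left(\mathbf{b}^{\{2\}T}+z\,\mathbf{b}^{\{1\}T}\left(\mathbf{I}_{s^{\{1\}}\times s^{\{1\}}}-z\mathbf{A}^{\{1,1\}}\right)^{-1}\mathbf{A}^{\{1,2\}}\right)\left(z(\mathbf{C}^{\{2\}})^k-k(\mathbf{C}^{\{2\}})^{k-1}\right).$$ The coefficients $w_{k,\ell}$ are: $w_{0,0}=0$; $w_{0,1}=\mathbf{b}^{\{2\}T}\mathbf{1}_{s^{\{2\}}}-\mathbf{b}^{\{1\}T}\mathbf{1}_{s^{\{1\}}}$; $w_{0,\ell}=\mathbf{b}^{\{1\}T}(\mathbf{A}^{\{1,1\}})^{\ell-2}(\mathbf{A}^{\{1,2\}}\mathbf{1}_{s^{\{2\}}}-\mathbf{A}^{\{1,1\}}\mathbf{1}_{s^{\{1\}}})$ for $\ell>1$; and for $k>0$: $w_{k,0}=1-k\,\mathbf{b}^{\{2\}T}\mathbf{c}^{\{2\}\times(k-1)}$;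 $w_{k,1}=\mathbf{b}^{\{2\}T}\mathbf{c}^{\{2\}\times k}-k\,\mathbf{b}^{\{1\}T}\mathbf{A}^{\{1,2\}}\mathbf{c}^{\{2\}\times(k-1)}$; $w_{k,\ell}=\mathbf{b}^{\{1\}T}(\mathbf{A}^{\{1,1\}})^{\ell-2}\left(\mathbf{A}^{\{1,2\}}\mathbf{c}^{\{2\}\times k}-k\,\mathbf{A}^{\{1,1\}}\mathbf{A}^{\{1,2\}}\mathbf{c}^{\{2\}\times(k-1)}\right)$ for $\ell>1$. (For $k\ge1$ these are the Maclaurin coefficients of $W_k(z)=1+\widetilde W_k(z)\mathbf{1}_{s^{\{2\}}}$.) *)

theory Defs
  imports "HOL-Analysis.Analysis" "Jordan_Normal_Form.Gauss_Jordan_Elimination"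
begin

text \<open>
  Vectors and matrices are those of \<^theory>\<open>Jordan_Normal_Form.Matrix\<close>, whose dimensions are
  natural numbers and not types, so that an error constant can be quantified before the
  dimension of the differential equation. The competing syntax of HOL-Analysis is switched off.
\<close>

unbundle no vec_syntax
unbundle no inner_syntax
hide_const (open) Finite_Cartesian_Product.vec Finite_Cartesian_Product.mat

subsection \<open>Inner products on complex coordinate space\<close>

text \<open>
  The inner product is linear in its second argument. The opposite convention is obtained by
  swapping the arguments, which changes neither the real part nor the induced norm.
\<close>

definition inner_product :: "nat \<Rightarrow> (complex vec \<Rightarrow> complex vec \<Rightarrow> complex) \<Rightarrow> bool" where
  "inner_product d ip \<longleftrightarrow>
     (\<forall>u\<in>carrier_vec d. \<forall>v\<in>carrier_vec d. \<forall>w\<in>carrier_vec d. ip u (v + w) = ip u v + ip u w) \<and>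
     (\<forall>u\<in>carrier_vec d. \<forall>v\<in>carrier_vec d. \<forall>a. ip u (a \<cdot>\<^sub>v v) = a * ip u v) \<and>
     (\<forall>u\<in>carrier_vec d. \<forall>v\<in>carrier_vec d. ip u v = cnj (ip v u)) \<and>
     (\<forall>u\<in>carrier_vec d. u \<noteq> 0\<^sub>v d \<longrightarrow> 0 < Re (ip u u))"

definition ip_norm :: "(complex vec \<Rightarrow> complex vec \<Rightarrow> complex) \<Rightarrow> complex vec \<Rightarrow> real" where
  "ip_norm ip u = sqrt (Re (ip u u))"

subsection \<open>Higher derivatives on a real set\<close>

text \<open>Derivatives are taken within \<open>S\<close>, hence one-sided at the end points of an interval.\<close>

primrec nderiv_within :: "real set \<Rightarrow> nat \<Rightarrow> (real \<Rightarrow> complex) \<Rightarrow> real \<Rightarrow> complex" where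
  "nderiv_within S 0 f = f"
| "nderiv_within S (Suc k) f = (\<lambda>t. vector_derivative (nderiv_within S k f) (at t within S))"

definition times_differentiable_on :: "nat \<Rightarrow> (real \<Rightarrow> complex) \<Rightarrow> real set \<Rightarrow> bool" where
  "times_differentiable_on k f S \<longleftrightarrow>
     (\<forall>j<k. \<forall>t\<in>S. nderiv_within S j f differentiable (at t within S))"

definition vec_times_differentiable_on ::
    "nat \<Rightarrow> nat \<Rightarrow> (real \<Rightarrow> complex vec) \<Rightarrow> real set \<Rightarrow> bool" where
  "vec_times_differentiable_on d k f S \<longleftrightarrow> (\<forall>i<d. times_differentiable_on k (\<lambda>t. f t $ i) S)"

definition vec_nderiv_within ::
    "nat \<Rightarrow> real set \<Rightarrow> nat \<Rightarrow> (real \<Rightarrow> complex vec) \<Rightarrow> real \<Rightarrow> complex vec" where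
  "vec_nderiv_within d S k f t = vec d (\<lambda>i. nderiv_within S k (\<lambda>u. f u $ i) t)"

text \<open>\<open>y\<close> solves \<open>y' = L y + g\<close> on \<open>S\<close>.\<close>

definition solves_linear_ode ::
    "nat \<Rightarrow> complex mat \<Rightarrow> (real \<Rightarrow> complex vec) \<Rightarrow> (real \<Rightarrow> complex vec) \<Rightarrow> real set \<Rightarrow> bool" where
  "solves_linear_ode d L g y S \<longleftrightarrow>
     (\<forall>t\<in>S. y t \<in> carrier_vec d \<and>
        (\<forall>i<d. ((\<lambda>u. y u $ i) has_vector_derivative (L *\<^sub>v y t + g t) $ i) (at t within S)))"

subsection \<open>Matrix notions\<close>

definition ones_vec :: "nat \<Rightarrow> 'a :: one vec" where
  "ones_vec s = vec s (\<lambda>_. 1)"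

definition vec_pow :: "'a :: monoid_mult vec \<Rightarrow> nat \<Rightarrow> 'a vec" where
  "vec_pow v k = map_vec (\<lambda>x. x ^ k) v"

definition kron_mat :: "'a :: times mat \<Rightarrow> 'a mat \<Rightarrow> 'a mat" where
  "kron_mat A B = mat (dim_row A * dim_row B) (dim_col A * dim_col B)
     (\<lambda>(i, j). A $$ (i div dim_row B, j div dim_col B) * B $$ (i mod dim_row B, j mod dim_col B))"

definition vec_lincomb :: "nat \<Rightarrow> nat \<Rightarrow> (nat \<Rightarrow> real) \<Rightarrow> (nat \<Rightarrow> complex vec) \<Rightarrow> complex vec" where
  "vec_lincomb d s a V = vec d (\<lambda>r. \<Sum>j<s. complex_of_real (a j) * V j $ r)"

abbreviation cmat :: "real mat \<Rightarrow> complex mat" where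
  "cmat \<equiv> map_mat complex_of_real"

abbreviation cvec :: "real vec \<Rightarrow> complex vec" where
  "cvec \<equiv> map_vec complex_of_real"

subsection \<open>The GARK scheme\<close>

text \<open>Vector and matrix indices start at 0.\<close>

record gark =
  A11 :: "real mat"
  A12 :: "real mat"
  b1 :: "real vec"
  b2 :: "real vec"
  c2 :: "real vec"

definition gark_stages :: "gark \<Rightarrow> nat \<Rightarrow> nat \<Rightarrow> bool" where
  "gark_stages G s1 s2 \<longleftrightarrow> 0 < s1 \<and> 0 < s2 \<and>
     A11 G \<in> carrier_mat s1 s1 \<and> A12 G \<in> carrier_mat s1 s2 \<and>
     b1 G \<in> carrier_vec s1 \<and> b2 G \<in> carrier_vec s2 \<and> c2 G \<in> carrier_vec s2"

definition gark_step ::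
    "gark \<Rightarrow> nat \<Rightarrow> complex mat \<Rightarrow> (real \<Rightarrow> complex vec) \<Rightarrow> real \<Rightarrow> real \<Rightarrow>
       complex vec \<Rightarrow> complex vec \<Rightarrow> bool" where
  "gark_step G d L g h t u u' \<longleftrightarrow>
     (let s1 = dim_vec (b1 G); s2 = dim_vec (b2 G) in
      \<exists>Y. (\<forall>i<s1. Y i \<in> carrier_vec d \<and>
             Y i = u + complex_of_real h \<cdot>\<^sub>v vec_lincomb d s1 (\<lambda>j. A11 G $$ (i, j)) (\<lambda>j. L *\<^sub>v Y j)
                     + complex_of_real h \<cdot>\<^sub>v vec_lincomb d s2 (\<lambda>j. A12 G $$ (i, j))
                                              (\<lambda>j. g (t + c2 G $ j * h))) \<and>
          u' = u + complex_of_real h \<cdot>\<^sub>v vec_lincomb d s1 (\<lambda>j. b1 G $ j) (\<lambda>j. L *\<^sub>v Y j)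
                 + complex_of_real h \<cdot>\<^sub>v vec_lincomb d s2 (\<lambda>j. b2 G $ j)
                                          (\<lambda>j. g (t + c2 G $ j * h)))"

definition gark_solution ::
    "gark \<Rightarrow> nat \<Rightarrow> complex mat \<Rightarrow> (real \<Rightarrow> complex vec) \<Rightarrow> real \<Rightarrow> real \<Rightarrow>
       complex vec \<Rightarrow> nat \<Rightarrow> (nat \<Rightarrow> complex vec) \<Rightarrow> bool" where
  "gark_solution G d L g h t0 y0 n u \<longleftrightarrow>
     u 0 = y0 \<and> (\<forall>m<n. gark_step G d L g h (t0 + real m * h) (u m) (u (Suc m)))"

definition gark_solvable :: "gark \<Rightarrow> nat \<Rightarrow> complex mat \<Rightarrow> real \<Rightarrow> bool" where
  "gark_solvable G d L h \<longleftrightarrow>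
     invertible_mat (1\<^sub>m (dim_vec (b1 G) * d) - kron_mat (cmat (A11 G)) (complex_of_real h \<cdot>\<^sub>m L))"

definition gark_interval :: "gark \<Rightarrow> real \<Rightarrow> real \<Rightarrow> real \<Rightarrow> real set" where
  "gark_interval G h t0 tf =
     {t0 + Min (insert 0 (set\<^sub>v (c2 G))) * h .. tf + Max (insert 0 ((\<lambda>c. c - 1) ` set\<^sub>v (c2 G))) * h}"

subsection \<open>Stability function, A-stability and order conditions\<close>

definition stage_mat :: "real mat \<Rightarrow> complex \<Rightarrow> complex mat" where
  "stage_mat A z = 1\<^sub>m (dim_row A) - z \<cdot>\<^sub>m cmat A"

definition stage_inverse :: "real mat \<Rightarrow> complex \<Rightarrow> complex mat" where
  "stage_inverse A z = the (mat_inverse (stage_mat A z))"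

definition stab_fun :: "real mat \<Rightarrow> real vec \<Rightarrow> complex \<Rightarrow> complex" where
  "stab_fun A b z = 1 + z * (cvec b \<bullet> (stage_inverse A z *\<^sub>v ones_vec (dim_row A)))"

text \<open>
  The stability function is read as the formula that defines it: a bound on its value at \<open>z\<close>
  includes that the inverse in the formula exists at \<open>z\<close>. Without this, a pole of the resolvent
  in the left half-plane that cancels in the stability function (but not in
  \<open>W_tilde\<close> below) would be permitted.
\<close>

definition A_stable :: "real mat \<Rightarrow> real vec \<Rightarrow> bool" where
  "A_stable A b \<longleftrightarrow>
     (\<forall>z. Re z \<le> 0 \<longrightarrow> invertible_mat (stage_mat A z) \<and> cmod (stab_fun A b z) \<le> 1)"

text \<open>A row vector is a matrix with one row.\<close>

definition W_tilde :: "gark \<Rightarrow> nat \<Rightarrow> complex \<Rightarrow> complex mat" where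
  "W_tilde G k z =
     (let C = mat_diag (dim_vec (c2 G)) (\<lambda>j. complex_of_real (c2 G $ j)) in
      (mat_of_row (cvec (b2 G))
        + z \<cdot>\<^sub>m (mat_of_row (cvec (b1 G)) * stage_inverse (A11 G) z * cmat (A12 G)))
      * (z \<cdot>\<^sub>m (C ^\<^sub>m k) - of_nat k \<cdot>\<^sub>m (C ^\<^sub>m (k - 1))))"

definition W_tilde_bounded_on :: "gark \<Rightarrow> nat \<Rightarrow> complex set \<Rightarrow> bool" where
  "W_tilde_bounded_on G k Z \<longleftrightarrow>
     (\<exists>B. \<forall>z\<in>Z. invertible_mat (stage_mat (A11 G) z) \<and>
        (\<forall>j<dim_vec (c2 G). cmod (W_tilde G k z $$ (0, j)) \<le> B))"

definition w_coeff :: "gark \<Rightarrow> nat \<Rightarrow> nat \<Rightarrow> real" where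
  "w_coeff G k l =
     (let s1 = dim_vec (b1 G); s2 = dim_vec (b2 G) in
      if k = 0 then
        (if l = 0 then 0
         else if l = 1 then b2 G \<bullet> ones_vec s2 - b1 G \<bullet> ones_vec s1
         else b1 G \<bullet> (A11 G ^\<^sub>m (l - 2) *\<^sub>v (A12 G *\<^sub>v ones_vec s2 - A11 G *\<^sub>v ones_vec s1)))
      else
        (if l = 0 then 1 - real k * (b2 G \<bullet> vec_pow (c2 G) (k - 1))
         else if l = 1 then b2 G \<bullet> vec_pow (c2 G) k
                            - real k * (b1 G \<bullet> (A12 G *\<^sub>v vec_pow (c2 G) (k - 1)))
         else b1 G \<bullet> (A11 G ^\<^sub>m (l - 2) *\<^sub>v
                (A12 G *\<^sub>v vec_pow (c2 G) k
                 - real k \<cdot>\<^sub>v (A11 G *\<^sub>v (A12 G *\<^sub>v vec_pow (c2 G) (k - 1)))))))"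

end

theory Submission
  imports Defs "HOL-Computational_Algebra.Fundamental_Theorem_Algebra"
    "Jordan_Normal_Form.Determinant" "HOL-Library.Function_Algebras"
begin

text \<open>
  Write \<open>Z = h L\<close>. Every quantity that a step of the scheme produces is a rational function of the
  single operator \<open>Z\<close>, with the common denominator \<open>Q(z) = det (I - z A)\<close>, where \<open>A\<close> is the matrix
  of the base method. Eliminating the stages with the adjugate of \<open>I - z A\<close> gives
  \<open>Q(Z) u' = P(Z) u + \<Sum>\<^sub>j N\<^sub>j(Z) f\<^sub>j\<close> with \<open>f\<^sub>j = h g(t + c\<^sub>j h)\<close>; here \<open>P / Q\<close> is the stability function
  and \<open>N\<^sub>j / Q\<close> is the factor that the components of \<open>W_tilde\<close> share (\<open>scheme_step\<close>).

  Insert \<open>f\<^sub>j = h y'(t + c\<^sub>j h) - Z y(t + c\<^sub>j h)\<close> for the exact solution \<open>y\<close> and expand by Taylor at \<open>t\<close>.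
  Up to \<open>h ^ k / k!\<close>, the defect of a step in the term with the \<open>k\<close>-th derivative is a polynomial in
  \<open>Z\<close> of degree at most \<open>s1 + 1\<close>, namely \<open>Q\<close> times the power series with coefficients \<open>w_coeff G k l\<close>. It vanishes identically once its first
  \<open>s1 + 2\<close> coefficients do (\<open>consistency_condition_poly\<close>, \<open>order_condition_poly\<close>). What remains is
  \<open>Q(Z) e' = P(Z) e + Q(Z) r + \<Sum>\<^sub>j (Z N\<^sub>j(Z) r\<^sub>j - N\<^sub>j(Z) r'\<^sub>j)\<close>, where the Taylor remainders \<open>r\<close>,
  \<open>r\<^sub>j\<close>, \<open>r'\<^sub>j\<close> are all of size \<open>h ^ (p + 1)\<close> times the supremum \<open>M\<close> of the norm of the \<open>(p + 1)\<close>-st derivative.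

  The bound must not depend on \<open>L\<close>, on its dimension or on the inner product. This comes from
  von Neumann's inequality: if \<open>Z\<close> is dissipative, \<open>Q\<close> has no zero in the closed left half-plane and
  \<open>\<bar>P\<bar> \<le> K \<bar>Q\<bar>\<close> there, then \<open>\<parallel>P(Z) x\<parallel> \<le> K \<parallel>Q(Z) x\<parallel>\<close> (\<open>von_neumann_half_plane\<close>). A-stability
  gives \<open>K = 1\<close> for the propagated error. Boundedness of \<open>W_tilde\<close> on the half-plane \<open>Re z \<le> \<mu>\<close>
  is a statement about behaviour at infinity, hence about degrees: \<open>z N\<^sub>j\<close> and \<open>N\<^sub>j\<close> have degree at most
  \<open>degree Q\<close> whenever the corresponding remainder can be nonzero (\<open>forcing_num_bounds\<close>), and with
  the absence of poles this yields bounds on all of \<open>Re z \<le> 0\<close>. So each step adds at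
  most a constant times \<open>M h ^ (p + 1)\<close>, and the \<open>n = \<tau> / h\<close> steps add up to the order \<open>p\<close>.

  Von Neumann's inequality is proved without spectral theory. For a contraction \<open>T\<close> the form
  \<open>q(v) = \<parallel>v\<parallel>\<^sup>2 - \<parallel>T v\<parallel>\<^sup>2\<close> is positive semidefinite, so the orbit \<open>T ^ m v\<close> is a sequence in a
  semi-inner product space on which a polynomial of \<open>T\<close> acts as a polynomial of the backward shift;
  the discrete Fourier transform diagonalises the shift. Division by \<open>Q\<close> is replaced by a polynomial
  approximation of \<open>1 / Q\<close>, and the half-plane is reduced to the disc by the Cayley transform.
\<close>

hide_const (open) Module.smult

section \<open>Semi-inner products\<close>

text \<open>
  The form may be degenerate. This matters twice: the defect form of a contraction is in general
  only semidefinite, and \<open>\<complex>\<^sup>d\<close> will be modelled by functions on \<open>\<nat>\<close> whose values from \<open>d\<close> on are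
  invisible to the form.
\<close>

locale semi_inner_space = vector_space scale
  for scale :: "complex \<Rightarrow> 'v::ab_group_add \<Rightarrow> 'v"  (infixr \<open>\<cdot>\<close> 75) +
  fixes form :: "'v \<Rightarrow> 'v \<Rightarrow> complex"
  assumes form_add: "form u (v + w) = form u v + form u w"
    and form_scale: "form u (a \<cdot> v) = a * form u v"
    and form_cnj: "form u v = cnj (form v u)"
    and form_nonneg: "0 \<le> Re (form v v)"
begin

definition nrm :: "'v \<Rightarrow> real" where
  "nrm v = sqrt (Re (form v v))"

lemma nrm_nonneg [simp]: "0 \<le> nrm v"
  by (simp add: nrm_def form_nonneg)

lemma nrm_power2: "(nrm v)\<^sup>2 = Re (form v v)"
  by (simp add: nrm_def form_nonneg)

lemma form_add_left: "form (u + v) w = form u w + form v w"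
  using form_add[of w u v] form_cnj[of "u + v" w] form_cnj[of u w] form_cnj[of v w] by simp

lemma form_scale_left: "form (a \<cdot> u) w = cnj a * form u w"
  using form_scale[of w a u] form_cnj[of "a \<cdot> u" w] form_cnj[of u w] by simp

lemma form_0_right [simp]: "form u 0 = 0"
  using form_scale[of u 0 0] by simp

lemma form_0_left [simp]: "form 0 u = 0"
  using form_scale_left[of 0 0 u] by simp

lemma form_minus_right: "form u (- v) = - form u v"
  using form_scale[of u "-1" v] by simp

lemma form_minus_left: "form (- u) v = - form u v"
  using form_scale_left[of "-1" u v] by simp

lemma form_diff_right: "form u (v - w) = form u v - form u w"
  using form_add[of u v "- w"] by (simp add: form_minus_right)

lemma form_diff_left: "form (u - v) w = form u w - form v w"
  using form_add_left[of u "- v" w] by (simp add: form_minus_left)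

lemma form_sum_right: "form u (\<Sum>i\<in>I. f i) = (\<Sum>i\<in>I. form u (f i))"
  by (induction I rule: infinite_finite_induct) (simp_all add: form_add)

lemma form_sum_left: "form (\<Sum>i\<in>I. f i) u = (\<Sum>i\<in>I. form (f i) u)"
  by (induction I rule: infinite_finite_induct) (simp_all add: form_add_left)

lemma Re_form_commute: "Re (form u v) = Re (form v u)"
  using form_cnj[of u v] by simp

lemma nrm_0 [simp]: "nrm 0 = 0"
  by (simp add: nrm_def)

lemma Re_form_scale: "Re (form (a \<cdot> v) (a \<cdot> v)) = (cmod a)\<^sup>2 * Re (form v v)"
proof -
  have "form (a \<cdot> v) (a \<cdot> v) = (a * cnj a) * form v v"
    by (simp add: form_scale form_scale_left mult_ac)
  also have "\<dots> = complex_of_real ((cmod a)\<^sup>2) * form v v"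
    by (simp add: complex_mult_cnj cmod_power2)
  finally show ?thesis by simp
qed

lemma nrm_scale: "nrm (a \<cdot> v) = cmod a * nrm v"
  by (simp add: nrm_def Re_form_scale real_sqrt_mult)

lemma nrm_minus: "nrm (- v) = nrm v"
  using nrm_scale[of "-1" v] by simp

text \<open>
  Cauchy-Schwarz for the real part. The discriminant argument has to treat a vector of norm zero
  separately, because such a vector can be nonzero.
\<close>

lemma Re_form_le: "Re (form u v) \<le> nrm u * nrm v"
proof -
  define a b c where "a = Re (form u u)" and "b = Re (form u v)" and "c = Re (form v v)"
  have a: "0 \<le> a" and c: "0 \<le> c" by (simp_all add: a_def c_def form_nonneg)
  have quad: "0 \<le> a - 2 * t * b + t\<^sup>2 * c" for t :: real
  proof -
    have "0 \<le> Re (form (u - of_real t \<cdot> v) (u - of_real t \<cdot> v))" by (rule form_nonneg)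
    also have "\<dots> = a - 2 * t * b + t\<^sup>2 * c"
      using Re_form_commute[of u v]
      by (simp add: form_diff_right form_diff_left form_scale form_scale_left a_def b_def c_def
          power2_eq_square algebra_simps)
    finally show ?thesis .
  qed
  have "b\<^sup>2 \<le> a * c"
  proof (cases "c = 0")
    case True
    have "b = 0"
    proof (rule ccontr)
      assume "b \<noteq> 0"
      then show False using quad[of "(a + 1) / (2 * b)"] True by (simp add: field_simps)
    qed
    then show ?thesis using True by simp
  next
    case False
    then show ?thesis using quad[of "b / c"] c
      by (simp add: field_simps power2_eq_square)
  qed
  then have "b \<le> sqrt (a * c)" by (rule real_le_rsqrt)
  then show ?thesis by (simp add: nrm_def a_def b_def c_def real_sqrt_mult)
qed

lemma nrm_triangle: "nrm (u + v) \<le> nrm u + nrm v"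
proof -
  have "(nrm (u + v))\<^sup>2 = (nrm u)\<^sup>2 + 2 * Re (form u v) + (nrm v)\<^sup>2"
    using Re_form_commute[of u v] by (simp add: nrm_power2 form_add form_add_left)
  also have "\<dots> \<le> (nrm u + nrm v)\<^sup>2"
    using Re_form_le[of u v] by (simp add: power2_sum)
  finally show ?thesis by (rule power2_le_imp_le) simp
qed

lemma nrm_diff_triangle: "nrm (u - v) \<le> nrm u + nrm v"
  using nrm_triangle[of u "- v"] by (simp add: nrm_minus)

lemma nrm_sum_le: "nrm (\<Sum>i\<in>I. f i) \<le> (\<Sum>i\<in>I. nrm (f i))"
proof (induction I rule: infinite_finite_induct)
  case (insert x I)
  then show ?case using nrm_triangle[of "f x" "sum f I"] by simp
qed simp_all

end

section \<open>Polynomials of a linear operator\<close>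

text \<open>
  The vector space is a module over the polynomials, with the variable acting as \<open>T\<close>. All operators
  of the scheme belong to this commutative algebra, so identities between them are identities of
  polynomials.
\<close>

locale linear_operator = vector_space scale
  for scale :: "complex \<Rightarrow> 'v::ab_group_add \<Rightarrow> 'v"  (infixr \<open>\<cdot>\<close> 75) +
  fixes T :: "'v \<Rightarrow> 'v"
  assumes T_add: "T (u + v) = T u + T v"
    and T_scale: "T (a \<cdot> v) = a \<cdot> T v"
begin

lemma T_0 [simp]: "T 0 = 0"
  using T_scale[of 0 0] by simp

lemma T_sum: "T (\<Sum>i\<in>I. f i) = (\<Sum>i\<in>I. T (f i))"
  by (induction I rule: infinite_finite_induct) (simp_all add: T_add)

text \<open>\<open>op p v\<close> is \<open>p(T) v\<close>.\<close>

definition op :: "complex poly \<Rightarrow> 'v \<Rightarrow> 'v" where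
  "op p v = (\<Sum>k\<le>degree p. coeff p k \<cdot> (T ^^ k) v)"

lemma op_altdef:
  assumes "degree p \<le> n"
  shows "op p v = (\<Sum>k\<le>n. coeff p k \<cdot> (T ^^ k) v)"
  unfolding op_def
  by (rule sum.mono_neutral_left) (use assms in \<open>auto simp: coeff_eq_0\<close>)

lemma op_pCons: "op (pCons a p) v = a \<cdot> v + T (op p v)"
proof -
  have "op (pCons a p) v = (\<Sum>k\<le>Suc (degree p). coeff (pCons a p) k \<cdot> (T ^^ k) v)"
    by (rule op_altdef) (simp add: degree_pCons_le)
  also have "\<dots> = a \<cdot> v + (\<Sum>k\<le>degree p. coeff p k \<cdot> (T ^^ Suc k) v)"
    by (subst sum.atMost_Suc_shift) simp
  also have "(\<Sum>k\<le>degree p. coeff p k \<cdot> (T ^^ Suc k) v) = T (op p v)"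
    by (simp add: op_def T_sum T_scale)
  finally show ?thesis .
qed

lemma op_0 [simp]: "op 0 v = 0"
  by (simp add: op_def)

lemma op_1 [simp]: "op 1 v = v"
  by (simp add: one_pCons op_pCons)

lemma op_const: "op [:a:] v = a \<cdot> v"
  by (simp add: op_pCons)

lemma op_add: "op (p + q) v = op p v + op q v"
proof (induction p arbitrary: q)
  case (pCons a p)
  obtain b r where "q = pCons b r" by (rule pCons_cases)
  then show ?case using pCons.IH[of r] by (simp add: op_pCons T_add algebra_simps)
qed simp

lemma op_smult: "op (smult a p) v = a \<cdot> op p v"
  by (induction p) (simp_all add: op_pCons T_scale algebra_simps)

lemma op_minus: "op (- p) v = - op p v"
  using op_smult[of "-1" p v] by simp

lemma op_diff: "op (p - q) v = op p v - op q v"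
  using op_add[of p "- q" v] by (simp add: op_minus)

lemma op_sum: "op (\<Sum>i\<in>I. f i) v = (\<Sum>i\<in>I. op (f i) v)"
  by (induction I rule: infinite_finite_induct) (simp_all add: op_add)

lemma op_mult: "op (p * q) v = op p (op q v)"
  by (induction p) (simp_all add: op_pCons op_add op_smult)

lemma op_vec_add: "op p (u + v) = op p u + op p v"
  by (induction p) (simp_all add: op_pCons T_add algebra_simps)

lemma op_vec_scale: "op p (a \<cdot> v) = a \<cdot> op p v"
  by (induction p) (simp_all add: op_pCons T_scale algebra_simps)

lemma op_vec_0 [simp]: "op p 0 = 0"
  using op_vec_scale[of p 0 0] by simp

lemma op_vec_minus: "op p (- v) = - op p v"
  using op_vec_scale[of p "-1" v] by simp

lemma op_vec_diff: "op p (u - v) = op p u - op p v"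
  using op_vec_add[of p u "- v"] by (simp add: op_vec_minus)

lemma op_vec_sum: "op p (\<Sum>i\<in>I. f i) = (\<Sum>i\<in>I. op p (f i))"
  by (induction I rule: infinite_finite_induct) (simp_all add: op_vec_add)

lemma op_T: "op p (T v) = T (op p v)"
  by (induction p) (simp_all add: op_pCons T_add T_scale)

end

section \<open>Von Neumann's inequality for contractions\<close>

text \<open>
  Orthogonality of the characters of the cyclic group of order \<open>N\<close>.
\<close>

lemma sum_roots_of_unity:
  fixes N :: nat
  defines "e \<equiv> \<lambda>j::nat. cis (2 * pi * real j / real N)"
  assumes j: "j < N" and k: "k < N"
  shows "(\<Sum>m<N. cnj (e j ^ m) * e k ^ m) = (if j = k then of_nat N else 0)"
proof -
  have N: "N > 0" using j by simp
  define x where "x = cnj (e j) * e k"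
  have eq: "cnj (e j ^ m) * e k ^ m = x ^ m" for m
    by (simp add: x_def power_mult_distrib)
  have unit: "e i * cnj (e i) = 1" for i
    by (simp add: e_def cis_mult cis_cnj)
  have sum_eq: "(\<Sum>m<N. cnj (e j ^ m) * e k ^ m) = (\<Sum>m<N. x ^ m)"
    by (simp only: eq)
  show ?thesis
  proof (cases "j = k")
    case True
    then have "x = 1" using unit[of j] by (simp add: x_def mult.commute)
    then show ?thesis unfolding sum_eq using True by simp
  next
    case False
    have root: "e i ^ N = 1" if "i < N" for i
      using Complex.bij_betw_roots_unity[OF N] that unfolding bij_betw_def e_def by auto
    have "inj_on e {..<N}"
      using Complex.bij_betw_roots_unity[OF N] unfolding bij_betw_def e_def by auto
    then have ne: "e j \<noteq> e k" using False j k by (auto dest: inj_onD)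
    have "x \<noteq> 1"
    proof
      assume "x = 1"
      then have "e j * x = e j" by simp
      moreover have "e j * x = (e j * cnj (e j)) * e k" by (simp add: x_def mult_ac)
      ultimately show False using ne unit[of j] by simp
    qed
    moreover have "x ^ N = 1"
    proof -
      have "x ^ N = cnj (e j ^ N) * e k ^ N" by (simp add: x_def power_mult_distrib)
      then show ?thesis using root[OF j] root[OF k] by simp
    qed
    ultimately have "(\<Sum>m<N. x ^ m) = 0" by (simp add: geometric_sum)
    then show ?thesis unfolding sum_eq using False by simp
  qed
qed

context semi_inner_space
begin

lemma plancherel:
  fixes N :: nat and v :: "nat \<Rightarrow> 'v"
  defines "e \<equiv> \<lambda>j::nat. cis (2 * pi * real j / real N)"
  shows "(\<Sum>m<N. Re (form (\<Sum>j<N. e j ^ m \<cdot> v j) (\<Sum>j<N. e j ^ m \<cdot> v j)))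
       = real N * (\<Sum>j<N. Re (form (v j) (v j)))"
proof -
  have "(\<Sum>m<N. form (\<Sum>j<N. e j ^ m \<cdot> v j) (\<Sum>j<N. e j ^ m \<cdot> v j))
      = (\<Sum>m<N. \<Sum>j<N. \<Sum>k<N. (cnj (e j ^ m) * e k ^ m) * form (v j) (v k))"
    by (simp add: form_sum_right form_sum_left form_scale form_scale_left sum_distrib_left
        mult_ac)
       (subst (2) sum.swap, simp)
  also have "\<dots> = (\<Sum>j<N. \<Sum>m<N. \<Sum>k<N. (cnj (e j ^ m) * e k ^ m) * form (v j) (v k))"
    by (rule sum.swap)
  also have "\<dots> = (\<Sum>j<N. \<Sum>k<N. \<Sum>m<N. (cnj (e j ^ m) * e k ^ m) * form (v j) (v k))"
    by (intro sum.cong refl sum.swap)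
  also have "\<dots> = (\<Sum>j<N. \<Sum>k<N. (if j = k then of_nat N else 0) * form (v j) (v k))"
    by (intro sum.cong refl)
       (simp only: sum_distrib_right[symmetric] e_def, subst sum_roots_of_unity, auto)
  also have "\<dots> = (\<Sum>j<N. \<Sum>k<N. if j = k then of_nat N * form (v j) (v k) else 0)"
    by (intro sum.cong refl) simp
  also have "\<dots> = of_nat N * (\<Sum>j<N. form (v j) (v j))"
    by (simp add: sum_distrib_left)
  finally have "Re (\<Sum>m<N. form (\<Sum>j<N. e j ^ m \<cdot> v j) (\<Sum>j<N. e j ^ m \<cdot> v j))
       = Re (of_nat N * (\<Sum>j<N. form (v j) (v j)))" by simp
  then show ?thesis by simp
qed

text \<open>
  On sequences, multiplication by a polynomial of the backward shift becomes, after a Fourier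
  transform, multiplication by the values of the polynomial on the unit circle. A window of length
  \<open>M + degree f\<close> of \<open>u\<close> determines the first \<open>M\<close> terms of the result, and the transform of
  that length reproduces them without wrap-around; the terms beyond \<open>M\<close> only increase the left
  side.
\<close>

lemma correlation_bound:
  fixes u :: "nat \<Rightarrow> 'v" and f :: "complex poly"
  assumes f: "\<And>z. cmod z = 1 \<Longrightarrow> cmod (poly f z) \<le> K"
  defines "w \<equiv> \<lambda>m. \<Sum>k\<le>degree f. coeff f k \<cdot> u (m + k)"
  shows "(\<Sum>m<M. Re (form (w m) (w m))) \<le> K\<^sup>2 * (\<Sum>m<M + degree f. Re (form (u m) (u m)))"
proof (cases "M = 0")
  case True
  then show ?thesis by (simp add: sum_nonneg form_nonneg)
next
  case False
  define N where "N = M + degree f"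
  have N: "N > 0" using False by (simp add: N_def)
  define e where "e = (\<lambda>j::nat. cis (2 * pi * real j / real N))"
  define v where "v = (\<lambda>j. (1 / of_nat N) \<cdot> (\<Sum>l<N. cnj (e j ^ l) \<cdot> u l))"
  have sym: "e j ^ m = e m ^ j" for j m
    unfolding e_def Complex.DeMoivre by (rule arg_cong[where f = cis]) simp
  have u: "u m = (\<Sum>j<N. e j ^ m \<cdot> v j)" if m: "m < N" for m
  proof -
    have "(\<Sum>j<N. e j ^ m \<cdot> v j)
        = (\<Sum>j<N. \<Sum>l<N. ((cnj (e j ^ l) * e j ^ m) / of_nat N) \<cdot> u l)"
      by (simp add: v_def scale_sum_right mult_ac)
    also have "\<dots> = (\<Sum>l<N. \<Sum>j<N. ((cnj (e j ^ l) * e j ^ m) / of_nat N) \<cdot> u l)"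
      by (rule sum.swap)
    also have "\<dots> = (\<Sum>l<N. ((\<Sum>j<N. cnj (e l ^ j) * e m ^ j) / of_nat N) \<cdot> u l)"
      by (simp only: sym[of _ m] scale_sum_left sum_divide_distrib)
         (simp only: sym[of l for l])
    also have "\<dots> = (\<Sum>l<N. if l = m then u l else 0)"
      by (intro sum.cong refl, simp only: e_def, subst sum_roots_of_unity)
         (use m N in auto)
    also have "\<dots> = u m" using m by simp
    finally show ?thesis by simp
  qed
  have w: "w m = (\<Sum>j<N. e j ^ m \<cdot> (poly f (e j) \<cdot> v j))" if m: "m < M" for m
  proof -
    have "w m = (\<Sum>k\<le>degree f. coeff f k \<cdot> (\<Sum>j<N. e j ^ (m + k) \<cdot> v j))"
      unfolding w_def
    proof (intro sum.cong refl)
      fix k assume "k \<in> {..degree f}"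
      then have "m + k < N" using m by (simp add: N_def)
      then show "coeff f k \<cdot> u (m + k) = coeff f k \<cdot> (\<Sum>j<N. e j ^ (m + k) \<cdot> v j)"
        using u by simp
    qed
    also have "\<dots> = (\<Sum>k\<le>degree f. \<Sum>j<N. (e j ^ m * (coeff f k * e j ^ k)) \<cdot> v j)"
      by (simp add: scale_sum_right power_add mult_ac)
    also have "\<dots> = (\<Sum>j<N. \<Sum>k\<le>degree f. (e j ^ m * (coeff f k * e j ^ k)) \<cdot> v j)"
      by (rule sum.swap)
    also have "\<dots> = (\<Sum>j<N. e j ^ m \<cdot> (poly f (e j) \<cdot> v j))"
      by (simp add: poly_altdef scale_sum_left[symmetric] sum_distrib_left[symmetric])
    finally show ?thesis .
  qed
  have "(\<Sum>m<M. Re (form (w m) (w m)))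
      = (\<Sum>m<M. Re (form (\<Sum>j<N. e j ^ m \<cdot> (poly f (e j) \<cdot> v j)) (\<Sum>j<N. e j ^ m \<cdot> (poly f (e j) \<cdot> v j))))"
    by (intro sum.cong refl) (simp add: w)
  also have "\<dots> \<le> (\<Sum>m<N. Re (form (\<Sum>j<N. e j ^ m \<cdot> (poly f (e j) \<cdot> v j)) (\<Sum>j<N. e j ^ m \<cdot> (poly f (e j) \<cdot> v j))))"
    by (rule sum_mono2) (auto simp: N_def form_nonneg)
  also have "\<dots> = real N * (\<Sum>j<N. Re (form (poly f (e j) \<cdot> v j) (poly f (e j) \<cdot> v j)))"
    unfolding e_def by (rule plancherel)
  also have "\<dots> \<le> real N * (\<Sum>j<N. K\<^sup>2 * Re (form (v j) (v j)))"
  proof (intro mult_left_mono sum_mono)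
    fix j
    have "cmod (poly f (e j)) \<le> K" by (rule f) (simp add: e_def)
    then have "(cmod (poly f (e j)))\<^sup>2 \<le> K\<^sup>2" by (simp add: power_mono)
    then show "Re (form (poly f (e j) \<cdot> v j) (poly f (e j) \<cdot> v j)) \<le> K\<^sup>2 * Re (form (v j) (v j))"
      by (simp add: Re_form_scale mult_right_mono form_nonneg)
  qed simp
  also have "\<dots> = K\<^sup>2 * (real N * (\<Sum>j<N. Re (form (v j) (v j))))"
    by (simp add: sum_distrib_left[symmetric] mult_ac)
  also have "real N * (\<Sum>j<N. Re (form (v j) (v j)))
      = (\<Sum>m<N. Re (form (\<Sum>j<N. e j ^ m \<cdot> v j) (\<Sum>j<N. e j ^ m \<cdot> v j)))"
    unfolding e_def by (rule plancherel[symmetric])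
  also have "\<dots> = (\<Sum>m<N. Re (form (u m) (u m)))"
    by (intro sum.cong refl) (simp add: u[symmetric])
  finally show ?thesis by (simp add: N_def)
qed

end

locale contraction = semi_inner_space scale form + linear_operator scale T
  for scale :: "complex \<Rightarrow> 'v::ab_group_add \<Rightarrow> 'v"  (infixr \<open>\<cdot>\<close> 75) and form and T +
  assumes contr: "Re (form (T v) (T v)) \<le> Re (form v v)"
begin

lemma nrm_T_le: "nrm (T v) \<le> nrm v"
  by (simp add: nrm_def contr)

lemma nrm_funpow_T_le: "nrm ((T ^^ k) v) \<le> nrm v"
  by (induction k) (auto intro: order_trans[OF nrm_T_le])

text \<open>
  Let \<open>a m\<close> and \<open>b m\<close> be the squared norms of \<open>T ^ m f(T) v\<close> and \<open>T ^ m v\<close>. Both decrease, and \<open>a 0\<close> is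
  \<open>a M\<close> plus the defects of the first \<open>M\<close> orbit points. The correlation bound for the defect form
  controls the second part by \<open>K\<^sup>2 (b 0 - b (M + n))\<close>. It need not hold that \<open>T ^ M v\<close> tends to zero, so
  the part \<open>a M\<close> is controlled by the same bound for the original form: averaged over the window it
  says that the limit of \<open>a\<close> is at most \<open>K\<^sup>2\<close> times the limit of \<open>b\<close>.
\<close>

lemma polynomial_bound:
  assumes f: "\<And>z. cmod z = 1 \<Longrightarrow> cmod (poly f z) \<le> K" and K: "0 \<le> K"
  shows "nrm (op f v) \<le> K * nrm v"
proof -
  interpret defect: semi_inner_space scale "\<lambda>u v. form u v - form (T u) (T v)"
  proof unfold_locales
    fix u v w and a :: complex
    show "form u (v + w) - form (T u) (T (v + w))
        = form u v - form (T u) (T v) + (form u w - form (T u) (T w))"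
      by (simp add: form_add T_add)
    show "form u (a \<cdot> v) - form (T u) (T (a \<cdot> v)) = a * (form u v - form (T u) (T v))"
      by (simp add: form_scale T_scale algebra_simps)
    show "form u v - form (T u) (T v) = cnj (form v u - form (T v) (T u))"
      using form_cnj[of u v] form_cnj[of "T u" "T v"] by simp
    show "0 \<le> Re (form v v - form (T v) (T v))"
      using contr[of v] by simp
  qed
  define n where "n = degree f"
  define a where "a = (\<lambda>m. Re (form ((T ^^ m) (op f v)) ((T ^^ m) (op f v))))"
  define b where "b = (\<lambda>m. Re (form ((T ^^ m) v) ((T ^^ m) v)))"
  have a0: "0 \<le> a m" and b0: "0 \<le> b m" for m
    by (simp_all add: a_def b_def form_nonneg)
  have a_Suc: "a (Suc m) \<le> a m" and b_Suc: "b (Suc m) \<le> b m" for m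
    by (simp_all add: a_def b_def contr)
  have a_mono: "a m \<le> a k" and b_mono: "b m \<le> b k" if "k \<le> m" for k m
    using that a_Suc b_Suc by (blast intro: lift_Suc_antimono_le)+
  have shift: "(\<Sum>k\<le>degree f. coeff f k \<cdot> (T ^^ (m + k)) v) = (T ^^ m) (op f v)" for m
  proof (induction m)
    case 0
    then show ?case by (simp add: op_def)
  next
    case (Suc m)
    have "(T ^^ Suc m) (op f v) = T (\<Sum>k\<le>degree f. coeff f k \<cdot> (T ^^ (m + k)) v)"
      by (simp add: Suc.IH)
    also have "\<dots> = (\<Sum>k\<le>degree f. coeff f k \<cdot> (T ^^ (Suc m + k)) v)"
      by (simp add: T_sum T_scale)
    finally show ?case by simp
  qed
  have window: "(\<Sum>m<M. a m) \<le> K\<^sup>2 * (\<Sum>m<M + n. b m)" for M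
    using correlation_bound[of f K "\<lambda>m. (T ^^ m) v" M, OF f]
    unfolding shift a_def b_def n_def .
  have window_defect: "a 0 - a M \<le> K\<^sup>2 * (b 0 - b (M + n))" for M
  proof -
    have "(\<Sum>m<M. a m - a (Suc m)) \<le> K\<^sup>2 * (\<Sum>m<M + n. b m - b (Suc m))"
      using defect.correlation_bound[of f K "\<lambda>m. (T ^^ m) v" M, OF f]
      unfolding shift a_def b_def n_def by simp
    then show ?thesis by (simp add: sum_lessThan_telescope')
  qed
  \<comment> \<open>\<open>B\<close> is the limit of \<open>b\<close>\<close>
  define B where "B = (INF m. b m)"
  have bdd: "bdd_below (range b)" using b0 by (auto intro: bdd_belowI[of _ 0])
  have B_le: "B \<le> b m" for m unfolding B_def using bdd by (rule cINF_lower) simp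
  have "a 0 \<le> K\<^sup>2 * b 0 + e" if e: "e > 0" for e
  proof -
    define c where "c = K\<^sup>2 + 1"
    have K1: "0 < c" by (simp add: c_def add_nonneg_pos)
    define \<delta> where "\<delta> = e / (2 * c)"
    have \<delta>: "\<delta> > 0" using e K1 by (simp add: \<delta>_def)
    have K\<delta>: "K\<^sup>2 * (2 * \<delta>) \<le> e"
    proof -
      have "K\<^sup>2 * (2 * \<delta>) \<le> c * (2 * \<delta>)" using \<delta> by (simp add: c_def)
      also have "\<dots> = e" using K1 by (simp add: \<delta>_def)
      finally show ?thesis .
    qed
    have "\<exists>m. b m < B + \<delta>"
    proof (rule ccontr)
      assume "\<not> ?thesis"
      then have "B + \<delta> \<le> B" unfolding B_def by (intro cINF_greatest) (auto simp: not_less)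
      then show False using \<delta> by simp
    qed
    then obtain m0 where m0: "b m0 < B + \<delta>" by blast
    define S where "S = (m0 + n) * b 0"
    \<comment> \<open>the window is so long that the \<open>m0 + n\<close> terms not yet near \<open>B\<close> do not affect the average\<close>
    obtain M :: nat where M: "M > 0" "M \<ge> m0" "S \<le> real M * \<delta>"
    proof -
      obtain M' :: nat where "S / \<delta> \<le> real M'" using real_arch_simple by blast
      then have "S \<le> real M' * \<delta>" using \<delta> by (simp add: field_simps)
      also have "\<dots> \<le> real (M' + m0 + 1) * \<delta>" using \<delta> by simp
      finally show ?thesis by (intro that[of "M' + m0 + 1"]) auto
    qed
    have "real M * a M = (\<Sum>m<M. a M)" by simp
    also have "\<dots> \<le> (\<Sum>m<M. a m)" by (intro sum_mono a_mono) simp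
    also have "\<dots> \<le> K\<^sup>2 * (\<Sum>m<M + n. b m)" by (rule window)
    also have "\<dots> \<le> K\<^sup>2 * (real M * (B + 2 * \<delta>))"
    proof (rule mult_left_mono)
      have "(\<Sum>m<M + n. b m) = (\<Sum>m<m0. b m) + (\<Sum>m=m0..<M. b m) + (\<Sum>m=M..<M + n. b m)"
      proof -
        have "(\<Sum>m<M. b m) = (\<Sum>m<m0. b m) + (\<Sum>m=m0..<M. b m)"
          using M sum.atLeastLessThan_concat[of 0 m0 M b] by (simp add: atLeast0LessThan)
        moreover have "(\<Sum>m<M + n. b m) = (\<Sum>m<M. b m) + (\<Sum>m=M..<M + n. b m)"
          using sum.atLeastLessThan_concat[of 0 M "M + n" b] by (simp add: atLeast0LessThan)
        ultimately show ?thesis by simp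
      qed
      also have "\<dots> \<le> (\<Sum>m<m0. b 0) + (\<Sum>m=m0..<M. b m0) + (\<Sum>m=M..<M + n. b 0)"
        by (intro add_mono sum_mono b_mono) auto
      also have "\<dots> = S + real (M - m0) * b m0" by (simp add: S_def algebra_simps)
      also have "\<dots> \<le> real M * \<delta> + real M * (B + \<delta>)"
        using M m0 b0[of m0] by (intro add_mono mult_mono) auto
      also have "\<dots> = real M * (B + 2 * \<delta>)" by (simp add: algebra_simps)
      finally show "(\<Sum>m<M + n. b m) \<le> real M * (B + 2 * \<delta>)" .
    qed simp
    finally have "real M * a M \<le> real M * (K\<^sup>2 * (B + 2 * \<delta>))" by (simp add: mult_ac)
    then have aM: "a M \<le> K\<^sup>2 * (B + 2 * \<delta>)" using M by simp
    have "a 0 \<le> a M + K\<^sup>2 * (b 0 - b (M + n))" using window_defect[of M] by simp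
    also have "\<dots> \<le> K\<^sup>2 * (B + 2 * \<delta>) + K\<^sup>2 * (b 0 - B)"
      by (intro add_mono aM mult_left_mono) (simp_all add: B_le)
    also have "\<dots> = K\<^sup>2 * b 0 + K\<^sup>2 * (2 * \<delta>)" by (simp add: algebra_simps)
    finally show ?thesis using K\<delta> by simp
  qed
  then have "a 0 \<le> K\<^sup>2 * b 0" by (rule field_le_epsilon)
  then have "(nrm (op f v))\<^sup>2 \<le> (K * nrm v)\<^sup>2"
    by (simp add: a_def b_def nrm_power2 power_mult_distrib)
  then show ?thesis by (rule power2_le_imp_le) (use K in simp)
qed

text \<open>
  Each linear factor \<open>X - \<rho>\<close> of \<open>Q\<close> has \<open>\<bar>\<rho>\<bar> > 1\<close>, so a partial sum of the geometric series inverts it up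
  to \<open>(X / \<rho>) ^ N\<close>, which is small both on the circle and as an operator because \<open>T\<close> is a contraction.
  Both kinds of smallness are carried through the induction; \<open>N\<close> is chosen after the polynomial that
  inverts the remaining factors.
\<close>

lemma approximate_inverse:
  fixes Q :: "complex poly"
  assumes "\<And>z. cmod z \<le> 1 \<Longrightarrow> poly Q z \<noteq> 0" and "e > 0"
  shows "\<exists>g. nrm (op (1 - g * Q) v) \<le> e \<and> (\<forall>z. cmod z = 1 \<longrightarrow> cmod (1 - poly (g * Q) z) \<le> e)"
  using assms
proof (induction "degree Q" arbitrary: Q e)
  case 0
  then obtain c where c: "Q = [:c:]" by (metis degree_eq_zeroE)
  then have "c \<noteq> 0" using "0.prems"(1)[of 0] by simp
  then show ?case using "0.prems" c by (intro exI[of _ "[:1 / c:]"]) (simp add: one_pCons)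
next
  case (Suc n)
  have "\<not> constant (poly Q)" using Suc.hyps(2) by (simp add: constant_degree)
  then obtain \<rho> where \<rho>: "poly Q \<rho> = 0" using fundamental_theorem_of_algebra by blast
  then obtain Q1 where Q: "Q = [:- \<rho>, 1:] * Q1" by (metis dvdE poly_eq_0_iff_dvd)
  have \<rho>1: "cmod \<rho> > 1" using \<rho> Suc.prems(1)[of \<rho>] by (auto simp: not_le[symmetric])
  have "Q1 \<noteq> 0" using Q Suc.hyps(2) by auto
  then have deg: "n = degree Q1" using Suc.hyps(2) unfolding Q by (subst (asm) degree_mult_eq) auto
  have "\<And>z. cmod z \<le> 1 \<Longrightarrow> poly Q1 z \<noteq> 0" using Suc.prems(1) unfolding Q by auto
  then obtain g where g: "nrm (op (1 - g * Q1) v) \<le> e / 2"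
    "\<And>z. cmod z = 1 \<Longrightarrow> cmod (1 - poly (g * Q1) z) \<le> e / 2"
    using Suc.hyps(1)[OF deg, of "e / 2"] Suc.prems(2) by auto
  define C where "C = nrm (op (g * Q1) v) + (1 + e / 2)"
  have C: "C > 0" using Suc.prems(2) by (simp add: C_def add_nonneg_pos)
  define x where "x = 1 / \<rho>"
  have x: "cmod x < 1" using \<rho>1 by (auto simp: x_def norm_divide divide_less_eq)
  obtain N where N: "cmod x ^ N < e / 2 / C"
    using real_arch_pow_inv[of "e / 2 / C" "cmod x"] x C Suc.prems(2) by auto
  have N': "cmod x ^ N * C \<le> e / 2" using N C by (simp add: field_simps)
  \<comment> \<open>the partial sum of the geometric series for \<open>1 / (X - \<rho>)\<close>\<close>
  define l where "l = smult (- x) (\<Sum>k<N. [:0, x:] ^ k)"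
  have l: "l * [:- \<rho>, 1:] = 1 - [:0, x:] ^ N"
  proof -
    have "[:- \<rho>, 1:] = smult (- \<rho>) (1 - [:0, x:])"
      using \<rho>1 by (auto simp: x_def one_pCons)
    then have "l * [:- \<rho>, 1:] = smult (x * \<rho>) ((\<Sum>k<N. [:0, x:] ^ k) * (1 - [:0, x:]))"
      by (simp add: l_def mult_ac)
    also have "x * \<rho> = 1" using \<rho>1 by (auto simp: x_def)
    also have "(\<Sum>k<N. [:0, x:] ^ k) * (1 - [:0, x:]) = 1 - [:0, x:] ^ N"
      by (subst one_diff_power_eq) (simp add: mult.commute)
    finally show ?thesis by simp
  qed
  have split: "1 - (g * l) * Q = (1 - g * Q1) + g * Q1 * [:0, x:] ^ N"
  proof -
    have "(g * l) * Q = g * Q1 * (l * [:- \<rho>, 1:])" unfolding Q by (simp only: mult_ac)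
    then show ?thesis unfolding l by (simp add: algebra_simps)
  qed
  have opx: "op ([:0, x:] ^ N) w = x ^ N \<cdot> (T ^^ N) w" for w
    by (induction N) (simp_all add: op_mult op_pCons T_scale del: mult_pCons_left)
  show ?case
  proof (intro exI[of _ "g * l"] conjI allI impI)
    have "nrm (op (1 - (g * l) * Q) v)
        \<le> nrm (op (1 - g * Q1) v) + nrm (op (g * Q1 * [:0, x:] ^ N) v)"
      unfolding split op_add by (rule nrm_triangle)
    also have "nrm (op (g * Q1 * [:0, x:] ^ N) v) = cmod x ^ N * nrm ((T ^^ N) (op (g * Q1) v))"
      by (subst mult.commute) (simp only: op_mult[of "[:0, x:] ^ N"] opx nrm_scale norm_power)
    also have "\<dots> \<le> cmod x ^ N * C"
      using nrm_funpow_T_le[of N "op (g * Q1) v"] Suc.prems(2)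
      by (intro mult_left_mono) (auto simp: C_def)
    finally show "nrm (op (1 - (g * l) * Q) v) \<le> e" using g(1) N' by simp
  next
    fix z :: complex assume z: "cmod z = 1"
    have "poly (g * Q1) z = 1 - (1 - poly (g * Q1) z)" by simp
    then have "cmod (poly (g * Q1) z) \<le> 1 + e / 2"
      using norm_triangle_ineq4[of 1 "1 - poly (g * Q1) z"] g(2)[OF z] by simp
    then have "cmod (poly (g * Q1) z) \<le> C" by (simp add: C_def add_increasing)
    then have "cmod x ^ N * cmod (poly (g * Q1) z) \<le> e / 2"
      using N' by (meson mult_left_mono norm_ge_zero order_trans zero_le_power)
    have "1 - poly ((g * l) * Q) z = poly (1 - (g * l) * Q) z" by simp
    also have "\<dots> = (1 - poly (g * Q1) z) + poly (g * Q1) z * (x * z) ^ N"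
      unfolding split by (simp add: mult_ac)
    finally have "cmod (1 - poly ((g * l) * Q) z)
        \<le> cmod (1 - poly (g * Q1) z) + cmod (poly (g * Q1) z * (x * z) ^ N)"
      by (simp only: norm_triangle_ineq)
    also have "cmod (poly (g * Q1) z * (x * z) ^ N) = cmod x ^ N * cmod (poly (g * Q1) z)"
      by (simp add: norm_mult norm_power z del: poly_mult)
    finally show "cmod (1 - poly ((g * l) * Q) z) \<le> e"
      using g(2)[OF z] \<open>cmod x ^ N * cmod (poly (g * Q1) z) \<le> e / 2\<close> by linarith
  qed
qed

text \<open>
  If \<open>g\<close> nearly inverts \<open>Q\<close>, then \<open>P(T) v\<close> is nearly \<open>(P g)(T) (Q(T) v)\<close>, and \<open>P g\<close> is a polynomial with
  \<open>\<bar>P g\<bar> \<le> K \<bar>g Q\<bar>\<close> on the circle.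
\<close>

theorem von_neumann_disc:
  assumes Q: "\<And>z. cmod z \<le> 1 \<Longrightarrow> poly Q z \<noteq> 0"
    and PQ: "\<And>z. cmod z = 1 \<Longrightarrow> cmod (poly P z) \<le> K * cmod (poly Q z)"
  shows "nrm (op P v) \<le> K * nrm (op Q v)"
proof -
  have K: "0 \<le> K"
  proof -
    have "0 \<le> K * cmod (poly Q 1)" using order_trans[OF norm_ge_zero PQ[of 1]] by simp
    moreover have "cmod (poly Q 1) > 0" using Q[of 1] by simp
    ultimately show ?thesis by (simp add: zero_le_mult_iff)
  qed
  have "nrm (op P v) \<le> K * nrm (op Q v) + e" if e: "e > 0" for e
  proof -
    define \<delta> where "\<delta> = e / (1 + K * nrm (op Q v))"
    have pos: "0 < 1 + K * nrm (op Q v)" using K by (simp add: add_pos_nonneg)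
    have \<delta>: "\<delta> > 0" using e pos by (simp add: \<delta>_def)
    \<comment> \<open>the error \<open>1 - g Q\<close> has to be small after application of \<open>P(T)\<close>, which is what the approximation
      gives for the form pulled back along \<open>P(T)\<close>\<close>
    interpret P: contraction scale "\<lambda>u v. form (op P u) (op P v)" T
      by unfold_locales
        (use form_nonneg contr in \<open>auto simp: op_vec_add op_vec_scale form_add form_scale T_add T_scale op_T
          intro: form_cnj\<close>)
    have P_nrm: "P.nrm u = nrm (op P u)" for u by (simp add: P.nrm_def nrm_def)
    obtain g where g: "nrm (op P (op (1 - g * Q) v)) \<le> \<delta>"
      "\<And>z. cmod z = 1 \<Longrightarrow> cmod (1 - poly (g * Q) z) \<le> \<delta>"
      using P.approximate_inverse[of Q \<delta> v, OF Q \<delta>] unfolding P_nrm by auto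
    have "nrm (op (P * g) (op Q v)) \<le> (K * (1 + \<delta>)) * nrm (op Q v)"
    proof (rule polynomial_bound)
      fix z :: complex assume z: "cmod z = 1"
      have "poly (g * Q) z = 1 - (1 - poly (g * Q) z)" by simp
      then have gQ: "cmod (poly (g * Q) z) \<le> 1 + \<delta>"
        using norm_triangle_ineq4[of 1 "1 - poly (g * Q) z"] g(2)[OF z] by simp
      have "cmod (poly (P * g) z) = cmod (poly P z) * cmod (poly g z)" by (simp add: norm_mult)
      also have "\<dots> \<le> K * cmod (poly Q z) * cmod (poly g z)"
        by (intro mult_right_mono PQ z) simp
      also have "\<dots> = K * cmod (poly (g * Q) z)" by (simp add: norm_mult mult_ac)
      also have "\<dots> \<le> K * (1 + \<delta>)" using gQ K by (intro mult_left_mono)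
      finally show "cmod (poly (P * g) z) \<le> K * (1 + \<delta>)" .
    qed (use K \<delta> in simp)
    moreover have "op P v = op P (op (1 - g * Q) v) + op (P * g) (op Q v)"
      by (simp only: op_mult[symmetric] op_add[symmetric]) (simp add: algebra_simps)
    ultimately have "nrm (op P v) \<le> \<delta> + (K * (1 + \<delta>)) * nrm (op Q v)"
      using nrm_triangle[of "op P (op (1 - g * Q) v)" "op (P * g) (op Q v)"] g(1) by simp
    also have "\<dots> = K * nrm (op Q v) + \<delta> * (1 + K * nrm (op Q v))" by (simp add: algebra_simps)
    also have "\<dots> = K * nrm (op Q v) + e" using pos by (simp add: \<delta>_def)
    finally show ?thesis .
  qed
  then show ?thesis by (rule field_le_epsilon)
qed

end

section \<open>Von Neumann's inequality for dissipative operators\<close>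

text \<open>
  This is \<open>(z + 1) ^ n p((z - 1) / (z + 1))\<close> for \<open>degree p \<le> n\<close>. The substitution maps the closed unit
  disc without \<open>-1\<close> to the closed left half-plane; the value at \<open>-1\<close> records the coefficient of
  degree \<open>n\<close>, that is, the behaviour of \<open>p\<close> at infinity.
\<close>

definition cayley :: "nat \<Rightarrow> complex poly \<Rightarrow> complex poly" where
  "cayley n p = (\<Sum>k\<le>n. smult (coeff p k) ([:-1, 1:] ^ k * [:1, 1:] ^ (n - k)))"

lemma poly_cayley:
  assumes "degree p \<le> n" and "z \<noteq> -1"
  shows "poly (cayley n p) z = (z + 1) ^ n * poly p ((z - 1) / (z + 1))"
proof -
  have z: "z + 1 \<noteq> 0" using assms(2) by (simp add: add_eq_0_iff2)
  have "poly (cayley n p) z = (\<Sum>k\<le>n. coeff p k * ((z - 1) ^ k * (z + 1) ^ (n - k)))"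
    by (simp add: cayley_def poly_sum poly_power algebra_simps)
  also have "\<dots> = (\<Sum>k\<le>n. (z + 1) ^ n * (coeff p k * ((z - 1) / (z + 1)) ^ k))"
  proof (intro sum.cong refl)
    fix k assume "k \<in> {..n}"
    then have "(z + 1) ^ n = (z + 1) ^ k * (z + 1) ^ (n - k)" by (simp flip: power_add)
    then show "coeff p k * ((z - 1) ^ k * (z + 1) ^ (n - k))
        = (z + 1) ^ n * (coeff p k * ((z - 1) / (z + 1)) ^ k)"
      using z by (simp add: power_divide)
  qed
  also have "\<dots> = (z + 1) ^ n * poly p ((z - 1) / (z + 1))"
    using assms(1)
    by (simp add: poly_altdef sum_distrib_left[symmetric] sum.mono_neutral_left[of "{..n}" "{..degree p}"]
        coeff_eq_0)
  finally show ?thesis .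
qed

lemma poly_cayley_minus_1: "poly (cayley n p) (-1) = coeff p n * (-2) ^ n"
proof -
  have "poly (cayley n p) (-1) = (\<Sum>k\<le>n. if k = n then coeff p n * (-2) ^ n else 0)"
    unfolding cayley_def poly_sum
    by (intro sum.cong refl) (auto simp: poly_power power_0_left)
  then show ?thesis by simp
qed

lemma cayley_Suc:
  "cayley (Suc n) (pCons a p) = smult a ([:1, 1:] ^ Suc n) + [:-1, 1:] * cayley n p"
  unfolding cayley_def sum_distrib_left
  by (subst sum.atMost_Suc_shift) (simp add: mult_ac del: mult_pCons_left mult_pCons_right)

lemma Re_cayley_le:
  fixes z :: complex
  assumes "cmod z \<le> 1"
  shows "Re ((z - 1) / (z + 1)) \<le> 0"
proof -
  have "(Re z)\<^sup>2 + (Im z)\<^sup>2 \<le> 1"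
    using power_mono[OF assms, of 2] by (simp add: cmod_power2)
  then have "(Re z - 1) * (Re z + 1) + Im z * Im z \<le> 0"
    by (simp add: algebra_simps power2_eq_square)
  then show ?thesis by (simp add: Re_divide divide_le_0_iff)
qed

text \<open>
  An inequality between \<open>P\<close> and \<open>Q\<close> far out on the negative axis becomes one between their transforms
  just to the right of \<open>-1\<close>, and continuity carries it to \<open>-1\<close>.
\<close>

lemma coeff_le_of_bounded:
  fixes P Q :: "complex poly" and m K :: real
  assumes bound: "\<And>x. x \<le> m \<Longrightarrow> cmod (poly P (of_real x)) \<le> K * cmod (poly Q (of_real x))"
    and deg: "degree P \<le> n" "degree Q \<le> n"
  shows "cmod (coeff P n) \<le> K * cmod (coeff Q n)"
proof -
  have lim: "((\<lambda>t::real. cmod (poly (cayley n p) (of_real t - 1))) \<longlongrightarrow> cmod (poly (cayley n p) (-1)))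
      (at_right 0)" for p
    by (rule tendsto_eq_intros refl poly_isCont[THEN isCont_tendsto_compose] | simp)+
  have ev: "\<forall>\<^sub>F t in at_right 0. cmod (poly (cayley n P) (of_real t - 1))
      \<le> K * cmod (poly (cayley n Q) (of_real t - 1))"
  proof -
    have "0 < 2 / (1 + \<bar>m\<bar>)" by (simp add: add_pos_nonneg)
    then have "\<forall>\<^sub>F t in at_right 0. t \<in> {0<..<2 / (1 + \<bar>m\<bar>)}"
      by (rule eventually_at_right_real)
    then show ?thesis
    proof eventually_elim
      case (elim t)
      then have t: "0 < t" "t * (1 + \<bar>m\<bar>) < 2" by (auto simp: field_simps add_pos_nonneg)
      define x where "x = (t - 2) / t"
      have "t * m \<ge> t * (- \<bar>m\<bar>)" using t by (intro mult_left_mono) auto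
      then have "t - 2 \<le> m * t" using t by (simp add: algebra_simps)
      then have x: "x \<le> m" using t by (simp add: x_def divide_le_eq)
      define z where "z = complex_of_real t - 1"
      have z: "z \<noteq> -1" using t by (simp add: z_def)
      have zx: "(z - 1) / (z + 1) = of_real x" using t by (simp add: z_def x_def)
      have "cmod (poly (cayley n P) z) = cmod (z + 1) ^ n * cmod (poly P (of_real x))"
        using poly_cayley[OF deg(1) z] zx by (simp add: norm_mult norm_power)
      also have "\<dots> \<le> cmod (z + 1) ^ n * (K * cmod (poly Q (of_real x)))"
        by (intro mult_left_mono bound x) simp
      also have "\<dots> = K * cmod (poly (cayley n Q) z)"
        using poly_cayley[OF deg(2) z] zx by (simp add: norm_mult norm_power)
      finally show ?case by (simp add: z_def)
    qed
  qed
  have "cmod (poly (cayley n P) (-1)) \<le> K * cmod (poly (cayley n Q) (-1))"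
    by (rule tendsto_le[OF _ tendsto_mult[OF tendsto_const lim] lim ev]) simp
  then have "cmod (coeff P n) * 2 ^ n \<le> (K * cmod (coeff Q n)) * 2 ^ n"
    by (simp add: poly_cayley_minus_1 norm_mult norm_power)
  then show ?thesis by simp
qed

lemma degree_le_of_bounded:
  fixes P Q :: "complex poly" and m K :: real
  assumes "\<And>x. x \<le> m \<Longrightarrow> cmod (poly P (of_real x)) \<le> K * cmod (poly Q (of_real x))"
  shows "degree P \<le> degree Q"
proof (rule ccontr)
  assume "\<not> ?thesis"
  then have less: "degree Q < degree P" by simp
  then have "cmod (lead_coeff P) \<le> K * cmod (coeff Q (degree P))"
    by (intro coeff_le_of_bounded[of m] assms) auto
  then have "lead_coeff P = 0" using less by (simp add: coeff_eq_0)
  then show False using less by simp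
qed

lemma cayley_nonzero:
  assumes Q: "\<And>z. Re z \<le> 0 \<Longrightarrow> poly Q z \<noteq> 0" and z: "cmod z \<le> 1"
  shows "poly (cayley (degree Q) Q) z \<noteq> 0"
proof (cases "z = -1")
  case True
  have "Q \<noteq> 0" using Q[of 0] by auto
  then show ?thesis unfolding True poly_cayley_minus_1 by simp
next
  case False
  then have "z + 1 \<noteq> 0" by (simp add: add_eq_0_iff2)
  then show ?thesis using Q[OF Re_cayley_le[OF z]] by (simp add: poly_cayley[OF order_refl False])
qed

text \<open>
  With \<open>n = degree Q\<close> the transform of \<open>Q\<close> has no zero on the closed disc, not even at \<open>-1\<close>, so the
  quotient of the transforms is continuous on a compact set.
\<close>

lemma bounded_of_degree_le:
  assumes Q: "\<And>z. Re z \<le> 0 \<Longrightarrow> poly Q z \<noteq> 0" and deg: "degree P \<le> degree Q"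
  shows "\<exists>K. \<forall>z. Re z \<le> 0 \<longrightarrow> cmod (poly P z) \<le> K * cmod (poly Q z)"
proof -
  define n where "n = degree Q"
  have "continuous_on (cball 0 1) (\<lambda>z. poly (cayley n P) z / poly (cayley n Q) z)"
    using cayley_nonzero[OF Q] by (intro continuous_intros) (auto simp: n_def)
  then have "compact ((\<lambda>z. poly (cayley n P) z / poly (cayley n Q) z) ` cball 0 1)"
    by (rule compact_continuous_image) simp
  then have "bounded ((\<lambda>z. poly (cayley n P) z / poly (cayley n Q) z) ` cball 0 1)"
    by (rule compact_imp_bounded)
  then obtain K where K: "\<And>z. cmod z \<le> 1 \<Longrightarrow> cmod (poly (cayley n P) z / poly (cayley n Q) z) \<le> K"
    unfolding bounded_iff ball_simps by (meson mem_cball_0)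
  have "cmod (poly P z) \<le> K * cmod (poly Q z)" if z: "Re z \<le> 0" for z
  proof -
    define w where "w = (1 + z) / (1 - z)"
    have z1: "1 - z \<noteq> 0" using z by auto
    have w1: "w + 1 = 2 / (1 - z)" using z1 by (simp add: w_def field_simps)
    have wm: "w - 1 = 2 * z / (1 - z)" using z1 by (simp add: w_def field_simps)
    have w0: "w + 1 \<noteq> 0" using z1 by (simp add: w1)
    then have w: "w \<noteq> -1" by auto
    have wz: "(w - 1) / (w + 1) = z" unfolding w1 wm using z1 by simp
    have "(cmod (1 + z))\<^sup>2 \<le> (cmod (1 - z))\<^sup>2"
      unfolding cmod_power2 using z by (simp add: power2_eq_square algebra_simps)
    then have "cmod (1 + z) \<le> cmod (1 - z)" by (rule power2_le_imp_le) simp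
    then have wn: "cmod w \<le> 1" using z1 by (simp add: w_def norm_divide divide_le_eq)
    have "cmod (poly (cayley n P) w) \<le> K * cmod (poly (cayley n Q) w)"
      using K[OF wn] cayley_nonzero[OF Q wn] by (simp add: norm_divide divide_le_eq n_def)
    then have "cmod (w + 1) ^ n * cmod (poly P z) \<le> cmod (w + 1) ^ n * (K * cmod (poly Q z))"
      using poly_cayley[OF deg[folded n_def] w] poly_cayley[OF order_refl w, of Q, folded n_def]
      by (simp add: wz norm_mult norm_power mult_ac)
    then show ?thesis using w0 by simp
  qed
  then show ?thesis by blast
qed

text \<open>
  The range condition on \<open>\<rho> - T\<close> is automatic in finite dimension with a definite form. Stated as an
  assumption, it makes the theory independent of dimension and admits degenerate forms.
\<close>

locale dissipative_operator = semi_inner_space scale form + linear_operator scale T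
  for scale :: "complex \<Rightarrow> 'v::ab_group_add \<Rightarrow> 'v"  (infixr \<open>\<cdot>\<close> 75) and form and T +
  assumes dissipative: "Re (form v (T v)) \<le> 0"
    and bij_resolvent: "0 < Re \<rho> \<Longrightarrow> bij (\<lambda>v. \<rho> \<cdot> v - T v)"
begin

text \<open>
  \<open>Q(T)\<close> is a product of factors \<open>T - \<rho>\<close> with \<open>Re \<rho> > 0\<close>.
\<close>

lemma bij_op:
  assumes "\<And>z. Re z \<le> 0 \<Longrightarrow> poly Q z \<noteq> 0"
  shows "bij (op Q)"
  using assms
proof (induction "degree Q" arbitrary: Q)
  case 0
  then obtain c where c: "Q = [:c:]" by (metis degree_eq_zeroE)
  then have "c \<noteq> 0" using "0.prems"[of 0] by simp
  then show ?case unfolding c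
    by (intro bij_betw_byWitness[where f' = "op [:1 / c:]"]) (auto simp: op_const)
next
  case (Suc n)
  have "\<not> constant (poly Q)" using Suc.hyps(2) by (simp add: constant_degree)
  then obtain \<rho> where \<rho>: "poly Q \<rho> = 0" using fundamental_theorem_of_algebra by blast
  then obtain Q1 where Q: "Q = [:- \<rho>, 1:] * Q1" by (metis dvdE poly_eq_0_iff_dvd)
  have \<rho>0: "0 < Re \<rho>" using \<rho> Suc.prems[of \<rho>] by (auto simp: not_le[symmetric])
  have "Q1 \<noteq> 0" using Q Suc.hyps(2) by auto
  then have deg: "n = degree Q1" using Suc.hyps(2) unfolding Q by (subst (asm) degree_mult_eq) auto
  have "\<And>z. Re z \<le> 0 \<Longrightarrow> poly Q1 z \<noteq> 0" using Suc.prems unfolding Q by auto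
  then have "bij (op Q1)" by (rule Suc.hyps(1)[OF deg])
  moreover have "bij (uminus :: 'v \<Rightarrow> 'v)" by (rule o_bij[of uminus]) auto
  ultimately have "bij (uminus \<circ> (\<lambda>v. \<rho> \<cdot> v - T v) \<circ> op Q1)"
    using bij_resolvent[OF \<rho>0] by (intro bij_comp)
  also have "uminus \<circ> (\<lambda>v. \<rho> \<cdot> v - T v) \<circ> op Q1 = op Q"
    unfolding Q by (rule ext) (simp add: op_mult op_pCons del: mult_pCons_left)
  finally show ?case .
qed

text \<open>
  The Cayley transform \<open>S = (1 + T) (1 - T)\<^sup>-\<^sup>1\<close> is a contraction, since
  \<open>\<parallel>w + T w\<parallel>\<^sup>2 - \<parallel>w - T w\<parallel>\<^sup>2 = 4 Re \<langle>w, T w\<rangle> \<le> 0\<close>. Because \<open>T (S + 1) = S - 1\<close>, the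
  transformed polynomial of \<open>S\<close> equals the original polynomial of \<open>T\<close> after the common factor
  \<open>(S + 1) ^ n\<close>, which is onto; so the inequality for the disc applies to a preimage of \<open>x\<close>.
\<close>

theorem von_neumann_half_plane:
  assumes Q: "\<And>z. Re z \<le> 0 \<Longrightarrow> poly Q z \<noteq> 0"
    and PQ: "\<And>z. Re z \<le> 0 \<Longrightarrow> cmod (poly P z) \<le> K * cmod (poly Q z)"
  shows "nrm (op P x) \<le> K * nrm (op Q x)"
proof -
  define R where "R = inv_into UNIV (\<lambda>v. 1 \<cdot> v - T v)"
  have bij1: "bij (\<lambda>v. 1 \<cdot> v - T v)" by (rule bij_resolvent) simp
  have R: "R v - T (R v) = v" for v
    using surj_f_inv_f[OF bij_is_surj[OF bij1], of v] by (simp add: R_def)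
  have R': "R (v - T v) = v" for v
    using inv_f_f[OF bij_is_inj[OF bij1], of v] by (simp add: R_def)
  have R_add: "R (u + v) = R u + R v" for u v
  proof -
    have "R u + R v = R ((R u + R v) - T (R u + R v))" by (simp only: R')
    also have "(R u + R v) - T (R u + R v) = (R u - T (R u)) + (R v - T (R v))"
      by (simp add: T_add)
    finally show ?thesis by (simp only: R)
  qed
  have R_scale: "R (a \<cdot> v) = a \<cdot> R v" for a v
  proof -
    have "a \<cdot> R v = R (a \<cdot> R v - T (a \<cdot> R v))" by (simp only: R')
    also have "a \<cdot> R v - T (a \<cdot> R v) = a \<cdot> (R v - T (R v))"
      by (simp add: T_scale scale_right_diff_distrib)
    finally show ?thesis by (simp only: R)
  qed
  \<comment> \<open>\<open>R\<close> is the resolvent of \<open>T\<close> at 1, and \<open>S\<close> the Cayley transform\<close>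
  define S where "S = (\<lambda>v. R v + T (R v))"
  interpret S: contraction scale form S
  proof unfold_locales
    fix u v and a :: complex
    show "S (u + v) = S u + S v" by (simp add: S_def R_add T_add)
    show "S (a \<cdot> v) = a \<cdot> S v" by (simp add: S_def R_scale T_scale scale_right_distrib)
    define w where "w = R v"
    have v: "v = w - T w" by (simp add: w_def R)
    show "Re (form (S v) (S v)) \<le> Re (form v v)"
      using dissipative[of w] Re_form_commute[of w "T w"] unfolding S_def w_def[symmetric]
      by (simp add: v form_add form_add_left form_diff_left form_diff_right)
  qed
  have S_plus: "v + S v = R v + R v" and S_minus: "S v - v = T (R v) + T (R v)" for v
    using R[of v] by (simp_all add: S_def algebra_simps)
  have op_X1: "S.op [:1, 1:] v = v + S v" for v by (simp add: S.op_pCons)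
  have op_Xm1: "S.op [:-1, 1:] v = S v - v" for v by (simp add: S.op_pCons)
  have intertwine: "S.op (cayley n p) w = op p (S.op ([:1, 1:] ^ n) w)" if "degree p \<le> n" for n p w
    using that
  proof (induction n arbitrary: p w)
    case 0
    then obtain c where "p = [:c:]" by (metis degree_eq_zeroE le_zero_eq)
    then show ?case by (simp add: cayley_def S.op_const op_const S.op_smult)
  next
    case (Suc n)
    obtain a q where p: "p = pCons a q" by (rule pCons_cases)
    have q: "degree q \<le> n" using Suc.prems by (cases "q = 0") (auto simp: p)
    have "S.op (cayley (Suc n) p) w
        = a \<cdot> S.op ([:1, 1:] ^ Suc n) w + S.op [:-1, 1:] (S.op (cayley n q) w)"
      unfolding p cayley_Suc by (simp only: S.op_add S.op_smult S.op_mult)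
    also have "S.op [:-1, 1:] (S.op (cayley n q) w) = T (S.op [:1, 1:] (S.op (cayley n q) w))"
      by (simp only: op_X1 op_Xm1 S_plus S_minus T_add)
    also have "S.op [:1, 1:] (S.op (cayley n q) w) = S.op (cayley n q) (S.op [:1, 1:] w)"
      by (simp only: S.op_mult[symmetric] mult.commute)
    also have "\<dots> = op q (S.op ([:1, 1:] ^ n) (S.op [:1, 1:] w))"
      by (rule Suc.IH[OF q])
    also have "S.op ([:1, 1:] ^ n) (S.op [:1, 1:] w) = S.op ([:1, 1:] ^ Suc n) w"
      by (simp only: S.op_mult[symmetric] power_Suc2)
    finally show ?case by (simp only: p op_pCons)
  qed
  have surj: "\<exists>w. S.op ([:1, 1:] ^ n) w = x" for n
  proof (induction n)
    case 0
    then show ?case by simp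
  next
    case (Suc n)
    then obtain w where w: "S.op ([:1, 1:] ^ n) w = x" by blast
    define v where "v = (1 / 2) \<cdot> (w - T w)"
    have "v + S v = (1/2 + 1/2) \<cdot> w"
      unfolding S_plus by (simp only: v_def R_scale R' scale_left_distrib)
    then have "v + S v = w" by simp
    then have "S.op ([:1, 1:] ^ Suc n) v = x"
      by (simp only: power_Suc2 S.op_mult op_X1 w)
    then show ?case by blast
  qed
  define n where "n = degree Q"
  have deg: "degree P \<le> n" unfolding n_def
    by (rule degree_le_of_bounded[of 0 P K]) (auto intro: PQ)
  obtain w where w: "S.op ([:1, 1:] ^ n) w = x" using surj by blast
  have "nrm (S.op (cayley n P) w) \<le> K * nrm (S.op (cayley n Q) w)"
  proof (rule S.von_neumann_disc)
    show "poly (cayley n Q) z \<noteq> 0" if "cmod z \<le> 1" for z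
      unfolding n_def using Q that by (rule cayley_nonzero)
    show "cmod (poly (cayley n P) z) \<le> K * cmod (poly (cayley n Q) z)" if z: "cmod z = 1" for z
    proof (cases "z = -1")
      case True
      have "cmod (coeff P n) \<le> K * cmod (coeff Q n)"
        using deg by (intro coeff_le_of_bounded[of 0]) (auto simp: n_def intro: PQ)
      then have "cmod (coeff P n) * 2 ^ n \<le> (K * cmod (coeff Q n)) * 2 ^ n"
        by (rule mult_right_mono) simp
      then show ?thesis unfolding True poly_cayley_minus_1 by (simp add: norm_mult norm_power mult_ac)
    next
      case False
      have "cmod (z + 1) ^ n * cmod (poly P ((z - 1) / (z + 1)))
          \<le> cmod (z + 1) ^ n * (K * cmod (poly Q ((z - 1) / (z + 1))))"
        by (intro mult_left_mono PQ Re_cayley_le) (simp_all add: z)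
      then show ?thesis using poly_cayley[OF deg False] poly_cayley[OF order_refl False, of Q]
        by (simp add: n_def norm_mult norm_power mult_ac)
    qed
  qed
  then show ?thesis using intertwine[OF deg] intertwine[of Q n] w by (simp add: n_def)
qed

end

section \<open>The polynomials of the scheme\<close>

text \<open>The matrix \<open>I - z A\<close> over the polynomials in \<open>z\<close>.\<close>

definition pencil :: "real mat \<Rightarrow> complex poly mat" where
  "pencil A = mat (dim_row A) (dim_row A)
     (\<lambda>(i, j). [: if i = j then 1 else 0, - complex_of_real (A $$ (i, j)) :])"

definition pencil_det :: "real mat \<Rightarrow> complex poly" where
  "pencil_det A = Determinant.det (pencil A)"

text \<open>The numerator of \<open>b\<^sup>T (I - z A)\<^sup>-\<^sup>1 v\<close> over the denominator \<open>det (I - z A)\<close>.\<close>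

definition resolvent_num :: "real mat \<Rightarrow> real vec \<Rightarrow> real vec \<Rightarrow> complex poly" where
  "resolvent_num A b v = (\<Sum>i<dim_row A. \<Sum>j<dim_row A.
     smult (complex_of_real (b $ i * v $ j)) (adj_mat (pencil A) $$ (i, j)))"

lemma pCons_0_sum: "pCons 0 (\<Sum>i\<in>I. f i) = (\<Sum>i\<in>I. pCons 0 (f i))"
proof (induction I rule: infinite_finite_induct)
  case (insert x I)
  then show ?case by (simp add: insert.IH[symmetric])
qed simp_all

lemma smult_sum_right: "smult a (\<Sum>i\<in>I. f i) = (\<Sum>i\<in>I. smult a (f i))"
  by (induction I rule: infinite_finite_induct) (simp_all add: smult_add_right)

lemma pencil_carrier: "A \<in> carrier_mat s s \<Longrightarrow> pencil A \<in> carrier_mat s s"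
  by (auto simp: pencil_def)

lemma pencil_index:
  assumes "A \<in> carrier_mat s s" "i < s" "j < s"
  shows "pencil A $$ (i, j) = (if i = j then 1 else 0) - pCons 0 [:complex_of_real (A $$ (i, j)):]"
  using assms by (auto simp: pencil_def one_pCons)

lemma adj_mat_pencil:
  assumes A: "A \<in> carrier_mat s s" and ij: "i < s" "j < s"
  shows "(\<Sum>k<s. adj_mat (pencil A) $$ (i, k) * pencil A $$ (k, j))
    = (if i = j then pencil_det A else 0)"
proof -
  note M = pencil_carrier[OF A] and adj = adj_mat(1)[OF pencil_carrier[OF A]]
  have "(adj_mat (pencil A) * pencil A) $$ (i, j)
      = (\<Sum>k<s. adj_mat (pencil A) $$ (i, k) * pencil A $$ (k, j))"
    using M adj ij by (auto simp: scalar_prod_def atLeast0LessThan intro!: sum.cong)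
  then show ?thesis unfolding adj_mat(3)[OF M] using ij by (auto simp: pencil_det_def)
qed

text \<open>
  Entrywise form of \<open>adj = Q I + z adj A\<close>, which is \<open>adj (I - z A) = Q I\<close> rearranged.
\<close>

lemma adj_mat_pencil_rec:
  assumes A: "A \<in> carrier_mat s s" and ij: "i < s" "j < s"
  shows "adj_mat (pencil A) $$ (i, j) = (if i = j then pencil_det A else 0)
    + pCons 0 (\<Sum>k<s. smult (complex_of_real (A $$ (k, j))) (adj_mat (pencil A) $$ (i, k)))"
    (is "?adj i j = _")
proof -
  have "(if i = j then pencil_det A else 0) = (\<Sum>k<s. ?adj i k * pencil A $$ (k, j))"
    by (rule adj_mat_pencil[OF A ij, symmetric])
  also have "\<dots> = (\<Sum>k<s. (if k = j then ?adj i k else 0)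
      - pCons 0 (smult (complex_of_real (A $$ (k, j))) (?adj i k)))"
  proof (intro sum.cong refl)
    fix k assume "k \<in> {..<s}"
    then have p: "pencil A $$ (k, j) = (if k = j then 1 else 0) - pCons 0 [:complex_of_real (A $$ (k, j)):]"
      using pencil_index[OF A _ ij(2)] by blast
    show "?adj i k * pencil A $$ (k, j) = (if k = j then ?adj i k else 0)
        - pCons 0 (smult (complex_of_real (A $$ (k, j))) (?adj i k))"
      unfolding p by (simp add: right_diff_distrib)
  qed
  also have "\<dots> = ?adj i j - pCons 0 (\<Sum>k<s. smult (complex_of_real (A $$ (k, j))) (?adj i k))"
    using ij by (simp add: sum_subtractf pCons_0_sum)
  finally show ?thesis by simp
qed

lemma degree_adj_mat_pencil:
  assumes A: "A \<in> carrier_mat s s" and ij: "i < s" "j < s"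
  shows "degree (adj_mat (pencil A) $$ (i, j)) \<le> s - 1"
proof -
  note M = pencil_carrier[OF A]
  define B where "B = mat_delete (pencil A) j i"
  have B: "B \<in> carrier_mat (s - 1) (s - 1)" using M by (auto simp: B_def mat_delete_def)
  have "degree (Determinant.det B) \<le> 1 * (s - 1)"
  proof (rule degree_det_le[OF _ B])
    fix k l assume "k < s - 1" "l < s - 1"
    then show "degree (B $$ (k, l)) \<le> 1"
      using A by (auto simp: B_def mat_delete_def pencil_def)
  qed
  moreover have "adj_mat (pencil A) $$ (i, j) = (-1) ^ (j + i) * Determinant.det B"
    using M ij by (auto simp: adj_mat_def Determinant.cofactor_def B_def)
  moreover have "degree ((-1) ^ (j + i) * Determinant.det B) = degree (Determinant.det B)"
    by (cases "even (j + i)") auto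
  ultimately show ?thesis by simp
qed

text \<open>
  One step of the Neumann series of \<open>(I - z A)\<^sup>-\<^sup>1\<close>, multiplied by the determinant so that it is an exact
  identity of polynomials.
\<close>

lemma resolvent_num_rec:
  assumes A: "A \<in> carrier_mat s s" and v: "v \<in> carrier_vec s"
  shows "resolvent_num A b v
    = smult (complex_of_real (b \<bullet> v)) (pencil_det A) + pCons 0 (resolvent_num A b (A *\<^sub>v v))"
proof -
  let ?a = "adj_mat (pencil A)"
  have dim: "dim_row A = s" using A by simp
  have "resolvent_num A b v
      = (\<Sum>i<s. \<Sum>j<s. smult (of_real (b $ i * v $ j)) (if i = j then pencil_det A else 0))
      + (\<Sum>i<s. \<Sum>j<s. smult (of_real (b $ i * v $ j))
          (pCons 0 (\<Sum>k<s. smult (of_real (A $$ (k, j))) (?a $$ (i, k)))))"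
    unfolding resolvent_num_def dim sum.distrib[symmetric]
    by (intro sum.cong refl) (use adj_mat_pencil_rec[OF A] in \<open>simp only: lessThan_iff smult_add_right\<close>)
  also have "(\<Sum>i<s. \<Sum>j<s. smult (of_real (b $ i * v $ j)) (if i = j then pencil_det A else 0))
      = smult (of_real (b \<bullet> v)) (pencil_det A)"
  proof -
    have "(\<Sum>i<s. \<Sum>j<s. smult (of_real (b $ i * v $ j)) (if i = j then pencil_det A else 0))
        = (\<Sum>i<s. \<Sum>j<s. if i = j then smult (of_real (b $ i * v $ i)) (pencil_det A) else 0)"
      by (intro sum.cong refl) auto
    also have "\<dots> = smult (of_real (b \<bullet> v)) (pencil_det A)"
      using v by (simp add: scalar_prod_def atLeast0LessThan smult_sum)
    finally show ?thesis .
  qed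
  also have "(\<Sum>i<s. \<Sum>j<s. smult (of_real (b $ i * v $ j))
          (pCons 0 (\<Sum>k<s. smult (of_real (A $$ (k, j))) (?a $$ (i, k)))))
      = pCons 0 (resolvent_num A b (A *\<^sub>v v))"
  proof -
    have "(\<Sum>i<s. \<Sum>j<s. smult (of_real (b $ i * v $ j))
          (pCons 0 (\<Sum>k<s. smult (of_real (A $$ (k, j))) (?a $$ (i, k)))))
        = (\<Sum>i<s. \<Sum>j<s. \<Sum>k<s. pCons 0 (smult (of_real (b $ i * (A $$ (k, j) * v $ j))) (?a $$ (i, k))))"
      by (simp add: smult_sum_right pCons_0_sum mult_ac)
    also have "\<dots> = (\<Sum>i<s. \<Sum>k<s. \<Sum>j<s. pCons 0 (smult (of_real (b $ i * (A $$ (k, j) * v $ j))) (?a $$ (i, k))))"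
      by (intro sum.cong refl sum.swap)
    also have "\<dots> = (\<Sum>i<s. \<Sum>k<s. pCons 0 (smult (of_real (b $ i * (A *\<^sub>v v) $ k)) (?a $$ (i, k))))"
    proof (intro sum.cong refl)
      fix i k assume "k \<in> {..<s}"
      then have "(A *\<^sub>v v) $ k = (\<Sum>j<s. A $$ (k, j) * v $ j)"
        using A v by (auto simp: scalar_prod_def atLeast0LessThan intro!: sum.cong)
      then show "(\<Sum>j<s. pCons 0 (smult (of_real (b $ i * (A $$ (k, j) * v $ j))) (?a $$ (i, k))))
          = pCons 0 (smult (of_real (b $ i * (A *\<^sub>v v) $ k)) (?a $$ (i, k)))"
        by (simp add: pCons_0_sum[symmetric] smult_sum[symmetric] sum_distrib_left)
    qed
    also have "\<dots> = pCons 0 (resolvent_num A b (A *\<^sub>v v))"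
      by (simp add: resolvent_num_def dim pCons_0_sum)
    finally show ?thesis .
  qed
  finally show ?thesis .
qed

lemma degree_resolvent_num:
  assumes A: "A \<in> carrier_mat s s"
  shows "degree (resolvent_num A b v) \<le> s - 1"
  unfolding resolvent_num_def
  by (intro degree_sum_le order_trans[OF degree_smult_le] degree_adj_mat_pencil[OF A])
     (use A in auto)

lemma resolvent_num_krylov:
  assumes A: "A \<in> carrier_mat s s" and v: "v \<in> carrier_vec s"
    and "\<And>l. l < m \<Longrightarrow> b \<bullet> (A ^\<^sub>m l *\<^sub>v v) = 0"
  shows "resolvent_num A b v = monom 1 m * resolvent_num A b (A ^\<^sub>m m *\<^sub>v v)"
  using v assms(3)
proof (induction m arbitrary: v)
  case 0
  then show ?case using A by (simp add: monom_0)
next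
  case (Suc m)
  have pow: "A ^\<^sub>m Suc l *\<^sub>v v = A ^\<^sub>m l *\<^sub>v (A *\<^sub>v v)" for l
    using A Suc.prems(1) by (simp add: assoc_mult_mat_vec[of _ s s _ s])
  have Av: "A *\<^sub>v v \<in> carrier_vec s" by (rule mult_mat_vec_carrier[OF A Suc.prems(1)])
  have "b \<bullet> v = 0" using Suc.prems(2)[of 0] A Suc.prems(1) by simp
  then have "resolvent_num A b v = pCons 0 (resolvent_num A b (A *\<^sub>v v))"
    using resolvent_num_rec[OF A Suc.prems(1), of b] by simp
  also have "resolvent_num A b (A *\<^sub>v v) = monom 1 m * resolvent_num A b (A ^\<^sub>m m *\<^sub>v (A *\<^sub>v v))"
    using Suc.prems(2)[of "Suc l" for l] unfolding pow by (intro Suc.IH[OF Av]) simp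
  finally show ?case unfolding pow by (simp add: monom_Suc)
qed

text \<open>
  Vanishing of the first \<open>s\<close> coefficients of the Neumann series makes the numerator divisible by
  \<open>z ^ s\<close>, but its degree is at most \<open>s - 1\<close>. This is why finitely many order conditions suffice.
\<close>

lemma resolvent_num_eq_0:
  assumes A: "A \<in> carrier_mat s s" and v: "v \<in> carrier_vec s"
    and zero: "\<And>l. l < s \<Longrightarrow> b \<bullet> (A ^\<^sub>m l *\<^sub>v v) = 0"
  shows "resolvent_num A b v = 0"
proof (cases "s = 0")
  case True
  then show ?thesis using A by (simp add: resolvent_num_def)
next
  case False
  define r where "r = resolvent_num A b (A ^\<^sub>m s *\<^sub>v v)"
  have eq: "resolvent_num A b v = monom 1 s * r"
    unfolding r_def by (rule resolvent_num_krylov[OF A v zero])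
  have "r = 0"
  proof (rule ccontr)
    assume "r \<noteq> 0"
    then have "degree (monom 1 s * r) = s + degree r"
      by (subst degree_mult_eq) (auto simp: degree_monom_eq)
    then show False using degree_resolvent_num[OF A, of b v] False unfolding eq by simp
  qed
  then show ?thesis using eq by simp
qed

lemma resolvent_num_diff:
  assumes "v \<in> carrier_vec (dim_row A)" "w \<in> carrier_vec (dim_row A)"
  shows "resolvent_num A b (v - w) = resolvent_num A b v - resolvent_num A b w"
  unfolding resolvent_num_def sum_subtractf[symmetric]
  using assms by (intro sum.cong refl) (auto simp: algebra_simps smult_diff_left)

lemma resolvent_num_smult:
  assumes "v \<in> carrier_vec (dim_row A)"
  shows "resolvent_num A b (r \<cdot>\<^sub>v v) = smult (complex_of_real r) (resolvent_num A b v)"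
  unfolding resolvent_num_def smult_sum_right
  using assms by (intro sum.cong refl) (auto simp: mult_ac)

lemma stage_mat_carrier: "A \<in> carrier_mat s s \<Longrightarrow> stage_mat A z \<in> carrier_mat s s"
  by (auto simp: stage_mat_def)

lemma poly_pencil_det:
  assumes A: "A \<in> carrier_mat s s"
  shows "poly (pencil_det A) z = Determinant.det (stage_mat A z)"
proof -
  interpret ev: comm_ring_hom "\<lambda>p. poly p z"
    by unfold_locales auto
  have "map_mat (\<lambda>p. poly p z) (pencil A) = stage_mat A z"
    using A by (intro eq_matI) (auto simp: pencil_def stage_mat_def)
  then show ?thesis using ev.hom_det[of "pencil A"] by (simp add: pencil_det_def)
qed

lemma pencil_det_nonzero:
  assumes A: "A \<in> carrier_mat s s" and inv: "invertible_mat (stage_mat A z)"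
  shows "poly (pencil_det A) z \<noteq> 0"
proof -
  note S = stage_mat_carrier[OF A, of z]
  obtain B where B: "stage_mat A z * B = 1\<^sub>m s" "B * stage_mat A z = 1\<^sub>m (dim_row B)"
    using inv S unfolding invertible_mat_def inverts_mat_def by auto
  have "B \<in> carrier_mat s s"
    using B S by (metis carrier_matD(2) carrier_matI index_mult_mat(3) index_one_mat(3) carrier_matD(1) index_mult_mat(2))
  then have "Determinant.det (stage_mat A z) * Determinant.det B = 1"
    using det_mult[OF S] B(1) by (metis det_one)
  then show ?thesis using poly_pencil_det[OF A] by auto
qed

lemma stage_inverse:
  assumes A: "A \<in> carrier_mat s s" and inv: "invertible_mat (stage_mat A z)"
  shows "stage_inverse A z \<in> carrier_mat s s" "stage_inverse A z * stage_mat A z = 1\<^sub>m s"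
proof -
  note S = stage_mat_carrier[OF A, of z]
  have "Determinant.det (stage_mat A z) \<noteq> 0"
    using pencil_det_nonzero[OF A inv] poly_pencil_det[OF A] by simp
  then have "stage_mat A z \<in> Units (ring_mat TYPE(complex) s ())"
    by (rule det_non_zero_imp_unit[OF S])
  then obtain B where B: "mat_inverse (stage_mat A z) = Some B"
    using mat_inverse(1)[OF S] by fastforce
  then show "stage_inverse A z \<in> carrier_mat s s" "stage_inverse A z * stage_mat A z = 1\<^sub>m s"
    using mat_inverse(2)[OF S B] by (simp_all add: stage_inverse_def)
qed

text \<open>
  Links the adjugate to the inverse in the definitions of the stability function and of \<open>W_tilde\<close>.
\<close>

lemma poly_adj_mat_pencil:
  assumes A: "A \<in> carrier_mat s s" and inv: "invertible_mat (stage_mat A z)" and ij: "i < s" "j < s"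
  shows "poly (adj_mat (pencil A) $$ (i, j)) z
    = poly (pencil_det A) z * stage_inverse A z $$ (i, j)"
proof -
  note S = stage_mat_carrier[OF A, of z] and M = pencil_carrier[OF A] and X = stage_inverse[OF A inv]
  note adj = adj_mat(1)[OF M]
  interpret ev: comm_ring_hom "\<lambda>p. poly p z"
    by unfold_locales auto
  define E where "E = map_mat (\<lambda>p. poly p z) (adj_mat (pencil A))"
  have E: "E \<in> carrier_mat s s" using adj by (simp add: E_def)
  have "map_mat (\<lambda>p. poly p z) (pencil A) = stage_mat A z"
    using A by (intro eq_matI) (auto simp: pencil_def stage_mat_def)
  then have "stage_mat A z * E = map_mat (\<lambda>p. poly p z) (pencil A * adj_mat (pencil A))"
    using ev.mat_hom_mult[OF M adj] by (simp add: E_def)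
  also have "\<dots> = poly (pencil_det A) z \<cdot>\<^sub>m 1\<^sub>m s"
    unfolding adj_mat(2)[OF M] by (intro eq_matI) (auto simp: pencil_det_def)
  finally have "stage_inverse A z * (stage_mat A z * E) = stage_inverse A z * (poly (pencil_det A) z \<cdot>\<^sub>m 1\<^sub>m s)"
    by simp
  also have "stage_inverse A z * (stage_mat A z * E) = E"
    using X S E by (simp add: assoc_mult_mat[symmetric, of _ s s _ s _ s])
  also have "stage_inverse A z * (poly (pencil_det A) z \<cdot>\<^sub>m 1\<^sub>m s) = poly (pencil_det A) z \<cdot>\<^sub>m stage_inverse A z"
    using X(1) by (simp add: mult_smult_distrib[of _ s s _ s])
  finally have "E $$ (i, j) = (poly (pencil_det A) z \<cdot>\<^sub>m stage_inverse A z) $$ (i, j)" by simp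
  then show ?thesis using ij X adj by (simp add: E_def)
qed

lemma poly_resolvent_num:
  assumes A: "A \<in> carrier_mat s s" and inv: "invertible_mat (stage_mat A z)"
    and b: "b \<in> carrier_vec s" and v: "v \<in> carrier_vec s"
  shows "poly (resolvent_num A b v) z
    = poly (pencil_det A) z * (\<Sum>i<s. \<Sum>j<s. complex_of_real (b $ i) * stage_inverse A z $$ (i, j) * complex_of_real (v $ j))"
  unfolding resolvent_num_def sum_distrib_left poly_sum
  using A by (intro sum.cong) (auto simp: poly_adj_mat_pencil[OF A inv] mult_ac)

subsection \<open>Stability and forcing polynomials\<close>

text \<open>The numerators of the stability function and of the factor by which the forcing value at the
  \<open>j\<close>-th node enters a step.\<close>

definition stability_num :: "gark \<Rightarrow> complex poly" where
  "stability_num G = pencil_det (A11 G)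
     + pCons 0 (resolvent_num (A11 G) (b1 G) (ones_vec (dim_row (A11 G))))"

definition forcing_num :: "gark \<Rightarrow> nat \<Rightarrow> complex poly" where
  "forcing_num G j = smult (complex_of_real (b2 G $ j)) (pencil_det (A11 G))
     + pCons 0 (resolvent_num (A11 G) (b1 G) (col (A12 G) j))"

context
  fixes G :: gark and s1 s2 :: nat
  assumes G: "gark_stages G s1 s2"
begin

lemma gark_carriers:
  "A11 G \<in> carrier_mat s1 s1" "A12 G \<in> carrier_mat s1 s2"
  "b1 G \<in> carrier_vec s1" "b2 G \<in> carrier_vec s2" "c2 G \<in> carrier_vec s2"
  using G by (auto simp: gark_stages_def)

lemma poly_stability_num:
  assumes "invertible_mat (stage_mat (A11 G) z)"
  shows "poly (stability_num G) z = poly (pencil_det (A11 G)) z * stab_fun (A11 G) (b1 G) z"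
proof -
  note X = stage_inverse(1)[OF gark_carriers(1) assms]
  have "cvec (b1 G) \<bullet> (stage_inverse (A11 G) z *\<^sub>v ones_vec s1)
      = (\<Sum>i<s1. \<Sum>j<s1. complex_of_real (b1 G $ i) * stage_inverse (A11 G) z $$ (i, j) * complex_of_real (ones_vec s1 $ j))"
    using gark_carriers X
    by (auto simp: scalar_prod_def atLeast0LessThan sum_distrib_left ones_vec_def mult_ac intro!: sum.cong)
  then show ?thesis
    using gark_carriers poly_resolvent_num[OF gark_carriers(1) assms gark_carriers(3), of "ones_vec s1"]
    by (simp add: stability_num_def stab_fun_def ones_vec_def algebra_simps)
qed

lemma poly_forcing_num:
  assumes inv: "invertible_mat (stage_mat (A11 G) z)" and j: "j < s2"
  shows "poly (pencil_det (A11 G)) z * W_tilde G k z $$ (0, j)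
    = poly (forcing_num G j) z
      * (z * complex_of_real (c2 G $ j) ^ k - of_nat k * complex_of_real (c2 G $ j) ^ (k - 1))"
proof -
  note X = stage_inverse(1)[OF gark_carriers(1) inv]
  define C where "C = mat_diag s2 (\<lambda>j. complex_of_real (c2 G $ j))"
  have C: "C \<in> carrier_mat s2 s2" by (simp add: C_def)
  have Cpow: "C ^\<^sub>m n = mat_diag s2 (\<lambda>j. complex_of_real (c2 G $ j) ^ n)" for n
  proof (induction n)
    case 0
    then show ?case by (simp add: C_def mat_diag_def)
  next
    case (Suc n)
    then show ?case by (simp add: C_def mult.commute)
  qed
  define D where "D = mat_diag s2 (\<lambda>j. z * complex_of_real (c2 G $ j) ^ k
      - of_nat k * complex_of_real (c2 G $ j) ^ (k - 1))"
  have D: "z \<cdot>\<^sub>m (C ^\<^sub>m k) - of_nat k \<cdot>\<^sub>m (C ^\<^sub>m (k - 1)) = D"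
    unfolding Cpow D_def by (intro eq_matI) (auto simp: mat_diag_def)
  define B where "B = mat_of_row (cvec (b2 G))
        + z \<cdot>\<^sub>m (mat_of_row (cvec (b1 G)) * stage_inverse (A11 G) z * cmat (A12 G))"
  have B: "B \<in> carrier_mat 1 s2" using gark_carriers X by (auto simp: B_def)
  have W: "W_tilde G k z = B * D"
    using gark_carriers by (simp add: W_tilde_def Let_def B_def C_def[symmetric] flip: D)
  have Bj: "B $$ (0, j) = complex_of_real (b2 G $ j) + z * (\<Sum>i<s1. \<Sum>l<s1. complex_of_real (b1 G $ i)
        * stage_inverse (A11 G) z $$ (i, l) * complex_of_real (col (A12 G) j $ l))"
    using gark_carriers X j
    by (auto simp: B_def scalar_prod_def atLeast0LessThan sum_distrib_right intro!: sum.swap)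
  have "poly (pencil_det (A11 G)) z * B $$ (0, j) = poly (forcing_num G j) z"
    using gark_carriers j poly_resolvent_num[OF gark_carriers(1) inv gark_carriers(3), of "col (A12 G) j"]
    by (simp add: Bj forcing_num_def algebra_simps)
  moreover have "W_tilde G k z $$ (0, j) = B $$ (0, j)
      * (z * complex_of_real (c2 G $ j) ^ k - of_nat k * complex_of_real (c2 G $ j) ^ (k - 1))"
    unfolding W D_def mat_diag_mult_right[OF B] using j by simp
  ultimately show ?thesis by (simp add: mult.assoc[symmetric])
qed

lemma sum_forcing_num:
  assumes a: "a \<in> carrier_vec s2"
  shows "(\<Sum>j<s2. smult (complex_of_real (a $ j)) (forcing_num G j))
    = smult (complex_of_real (b2 G \<bullet> a)) (pencil_det (A11 G))
      + pCons 0 (resolvent_num (A11 G) (b1 G) (A12 G *\<^sub>v a))"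
proof -
  have "(\<Sum>j<s2. smult (of_real (a $ j)) (resolvent_num (A11 G) (b1 G) (col (A12 G) j)))
      = (\<Sum>j<s2. \<Sum>i<s1. \<Sum>k<s1. smult (of_real (a $ j * (b1 G $ i * A12 G $$ (k, j))))
          (adj_mat (pencil (A11 G)) $$ (i, k)))"
    using gark_carriers by (auto simp: resolvent_num_def smult_sum_right intro!: sum.cong)
  also have "\<dots> = (\<Sum>i<s1. \<Sum>j<s2. \<Sum>k<s1. smult (of_real (a $ j * (b1 G $ i * A12 G $$ (k, j))))
          (adj_mat (pencil (A11 G)) $$ (i, k)))"
    by (rule sum.swap)
  also have "\<dots> = (\<Sum>i<s1. \<Sum>k<s1. \<Sum>j<s2. smult (of_real (a $ j * (b1 G $ i * A12 G $$ (k, j))))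
          (adj_mat (pencil (A11 G)) $$ (i, k)))"
    by (intro sum.cong refl sum.swap)
  also have "\<dots> = resolvent_num (A11 G) (b1 G) (A12 G *\<^sub>v a)"
  proof -
    have "(\<Sum>j<s2. smult (of_real (a $ j * (b1 G $ i * A12 G $$ (k, j)))) (adj_mat (pencil (A11 G)) $$ (i, k)))
        = smult (of_real (b1 G $ i * (A12 G *\<^sub>v a) $ k)) (adj_mat (pencil (A11 G)) $$ (i, k))"
      if "k < s1" for i k
    proof -
      have "(A12 G *\<^sub>v a) $ k = (\<Sum>j<s2. A12 G $$ (k, j) * a $ j)"
        using gark_carriers a that by (auto simp: scalar_prod_def atLeast0LessThan intro!: sum.cong)
      then show ?thesis by (simp add: smult_sum[symmetric] sum_distrib_left mult_ac)
    qed
    then show ?thesis using gark_carriers by (simp add: resolvent_num_def)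
  qed
  finally have "pCons 0 (\<Sum>j<s2. smult (of_real (a $ j)) (resolvent_num (A11 G) (b1 G) (col (A12 G) j)))
      = pCons 0 (resolvent_num (A11 G) (b1 G) (A12 G *\<^sub>v a))" by simp
  moreover have "(\<Sum>j<s2. smult (of_real (a $ j * b2 G $ j)) (pencil_det (A11 G)))
      = smult (complex_of_real (b2 G \<bullet> a)) (pencil_det (A11 G))"
    using a by (simp add: scalar_prod_def atLeast0LessThan smult_sum mult.commute)
  ultimately show ?thesis
    by (simp add: forcing_num_def smult_add_right sum.distrib pCons_0_sum)
qed

text \<open>
  The conditions for \<open>k = 0\<close> say that the scheme, applied to the constant solution \<open>y\<close> with
  \<open>f\<^sub>j = - z y\<close>, reproduces it.
\<close>

lemma consistency_condition_poly:
  assumes w: "\<And>l. l \<le> s1 + 1 \<Longrightarrow> w_coeff G 0 l = 0"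
  shows "pencil_det (A11 G) + pCons 0 (\<Sum>j<s2. forcing_num G j) = stability_num G"
proof -
  note c = gark_carriers
  define x where "x = A12 G *\<^sub>v ones_vec s2 - A11 G *\<^sub>v ones_vec s1"
  have ones: "ones_vec s1 \<in> carrier_vec s1" "ones_vec s2 \<in> carrier_vec s2"
    by (simp_all add: ones_vec_def)
  have v: "A12 G *\<^sub>v ones_vec s2 \<in> carrier_vec s1" "A11 G *\<^sub>v ones_vec s1 \<in> carrier_vec s1"
    using c ones by (auto intro: mult_mat_vec_carrier)
  have "b1 G \<bullet> (A11 G ^\<^sub>m l *\<^sub>v x) = 0" if "l < s1" for l
    using w[of "l + 2"] that c by (simp add: w_coeff_def x_def)
  then have x0: "resolvent_num (A11 G) (b1 G) x = 0"
    using c v by (intro resolvent_num_eq_0[of _ s1]) (auto simp: x_def)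
  have diff: "resolvent_num (A11 G) (b1 G) x = resolvent_num (A11 G) (b1 G) (A12 G *\<^sub>v ones_vec s2)
      - resolvent_num (A11 G) (b1 G) (A11 G *\<^sub>v ones_vec s1)"
    unfolding x_def using c v by (intro resolvent_num_diff) auto
  have b: "b2 G \<bullet> ones_vec s2 = b1 G \<bullet> ones_vec s1"
    using w[of 1] c by (simp add: w_coeff_def)
  have "(\<Sum>j<s2. forcing_num G j) = (\<Sum>j<s2. smult (complex_of_real (ones_vec s2 $ j)) (forcing_num G j))"
    by (simp add: ones_vec_def)
  also have "\<dots> = smult (complex_of_real (b1 G \<bullet> ones_vec s1)) (pencil_det (A11 G))
      + pCons 0 (resolvent_num (A11 G) (b1 G) (A11 G *\<^sub>v ones_vec s1))"
    unfolding sum_forcing_num[OF ones(2)] b using x0 diff by simp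
  also have "\<dots> = resolvent_num (A11 G) (b1 G) (ones_vec s1)"
    by (rule resolvent_num_rec[OF c(1) ones(1), symmetric])
  finally show ?thesis using c by (simp add: stability_num_def)
qed

text \<open>
  The polynomial form of \<open>1 + W_tilde k z 1 = 0\<close>. After splitting off the coefficients of \<open>z ^ 0\<close> and \<open>z ^ 1\<close>,
  which are \<open>w_coeff G k 0\<close> and \<open>w_coeff G k 1\<close> times the determinant, the rest is \<open>z\<^sup>2\<close> times a resolvent
  numerator whose Neumann coefficients are the remaining \<open>w_coeff G k l\<close>.
\<close>

lemma order_condition_poly:
  assumes k: "0 < k" and w: "\<And>l. l \<le> s1 + 1 \<Longrightarrow> w_coeff G k l = 0"
  shows "pencil_det (A11 G)
    + pCons 0 (\<Sum>j<s2. smult (complex_of_real (c2 G $ j ^ k)) (forcing_num G j))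
    = smult (of_nat k) (\<Sum>j<s2. smult (complex_of_real (c2 G $ j ^ (k - 1))) (forcing_num G j))"
proof -
  note c = gark_carriers
  define u where "u = vec_pow (c2 G) k"
  define v where "v = vec_pow (c2 G) (k - 1)"
  have uv: "u \<in> carrier_vec s2" "v \<in> carrier_vec s2" using c by (auto simp: u_def v_def vec_pow_def)
  define x where "x = A12 G *\<^sub>v u - real k \<cdot>\<^sub>v (A11 G *\<^sub>v (A12 G *\<^sub>v v))"
  have Av: "A12 G *\<^sub>v u \<in> carrier_vec s1" "A12 G *\<^sub>v v \<in> carrier_vec s1"
    "A11 G *\<^sub>v (A12 G *\<^sub>v v) \<in> carrier_vec s1"
    using c uv by (auto intro!: mult_mat_vec_carrier)
  have "b1 G \<bullet> (A11 G ^\<^sub>m l *\<^sub>v x) = 0" if "l < s1" for l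
    using w[of "l + 2"] that c k by (simp add: w_coeff_def x_def u_def v_def)
  then have x0: "resolvent_num (A11 G) (b1 G) x = 0"
    using c Av by (intro resolvent_num_eq_0[of _ s1]) (auto simp: x_def)
  have diff: "resolvent_num (A11 G) (b1 G) x = resolvent_num (A11 G) (b1 G) (A12 G *\<^sub>v u)
      - smult (of_real (real k)) (resolvent_num (A11 G) (b1 G) (A11 G *\<^sub>v (A12 G *\<^sub>v v)))"
    unfolding x_def using c Av by (subst resolvent_num_diff) (auto simp: resolvent_num_smult)
  have w0: "1 = real k * (b2 G \<bullet> v)" and w1: "b2 G \<bullet> u = real k * (b1 G \<bullet> (A12 G *\<^sub>v v))"
    using w[of 0] w[of 1] k by (simp_all add: w_coeff_def u_def v_def)
  let ?Q = "pencil_det (A11 G)"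
  let ?r = "resolvent_num (A11 G) (b1 G) (A11 G *\<^sub>v (A12 G *\<^sub>v v))"
  have U: "(\<Sum>j<s2. smult (complex_of_real (c2 G $ j ^ k)) (forcing_num G j))
      = smult (of_real (b2 G \<bullet> u)) ?Q + pCons 0 (smult (of_real (real k)) ?r)"
    using sum_forcing_num[OF uv(1)] x0 diff c by (simp add: u_def vec_pow_def)
  have V: "(\<Sum>j<s2. smult (complex_of_real (c2 G $ j ^ (k - 1))) (forcing_num G j))
      = smult (of_real (b2 G \<bullet> v)) ?Q
        + pCons 0 (smult (of_real (b1 G \<bullet> (A12 G *\<^sub>v v))) ?Q + pCons 0 ?r)"
    using sum_forcing_num[OF uv(2)] resolvent_num_rec[OF c(1) Av(2), of "b1 G"] c
    by (simp add: v_def vec_pow_def)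
  have 1: "smult (of_nat k) (smult (complex_of_real (b2 G \<bullet> v)) ?Q) = ?Q"
  proof -
    have "of_nat k * complex_of_real (b2 G \<bullet> v) = complex_of_real (real k * (b2 G \<bullet> v))" by simp
    then show ?thesis by (simp only: smult_smult w0[symmetric] of_real_1 smult_1_left)
  qed
  show ?thesis unfolding U V smult_add_right 1 by (simp add: w1 smult_add_right)
qed

end

section \<open>One step of the scheme\<close>

context linear_operator
begin

lemma op_resolvent_num:
  "op (resolvent_num A b v) w = (\<Sum>i<dim_row A. \<Sum>k<dim_row A.
     complex_of_real (b $ i * v $ k) \<cdot> op (adj_mat (pencil A) $$ (i, k)) w)"
  by (simp add: resolvent_num_def op_sum op_smult)

text \<open>
  Cramer's rule for the stage system, whose coefficients are polynomials of \<open>T\<close>: multiply the system by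
  the adjugate.
\<close>

lemma stage_elimination:
  assumes A: "A \<in> carrier_mat s s" and k: "k < s"
    and Y: "\<And>i. i < s \<Longrightarrow> Y i = r i + (\<Sum>j<s. complex_of_real (A $$ (i, j)) \<cdot> T (Y j))"
  shows "op (pencil_det A) (Y k) = (\<Sum>i<s. op (adj_mat (pencil A) $$ (k, i)) (r i))"
proof -
  have r: "r i = (\<Sum>j<s. op (pencil A $$ (i, j)) (Y j))" if i: "i < s" for i
  proof -
    have "(\<Sum>j<s. op (pencil A $$ (i, j)) (Y j))
        = (\<Sum>j<s. (if i = j then Y j else 0) - complex_of_real (A $$ (i, j)) \<cdot> T (Y j))"
    proof (intro sum.cong refl)
      fix j assume "j \<in> {..<s}"
      then have p: "pencil A $$ (i, j) = (if i = j then 1 else 0) - pCons 0 [:complex_of_real (A $$ (i, j)):]"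
        using pencil_index[OF A i] by blast
      show "op (pencil A $$ (i, j)) (Y j)
          = (if i = j then Y j else 0) - complex_of_real (A $$ (i, j)) \<cdot> T (Y j)"
        unfolding p op_diff by (simp add: op_pCons T_scale)
    qed
    also have "\<dots> = Y i - (\<Sum>j<s. complex_of_real (A $$ (i, j)) \<cdot> T (Y j))"
      using i by (simp add: sum_subtractf)
    finally show ?thesis using Y[OF i] by simp
  qed
  have "(\<Sum>i<s. op (adj_mat (pencil A) $$ (k, i)) (r i))
      = (\<Sum>i<s. \<Sum>j<s. op (adj_mat (pencil A) $$ (k, i) * pencil A $$ (i, j)) (Y j))"
    by (intro sum.cong refl) (simp add: r op_vec_sum op_mult)
  also have "\<dots> = (\<Sum>j<s. op (\<Sum>i<s. adj_mat (pencil A) $$ (k, i) * pencil A $$ (i, j)) (Y j))"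
    by (subst sum.swap) (simp add: op_sum)
  also have "\<dots> = (\<Sum>j<s. if k = j then op (pencil_det A) (Y j) else 0)"
    by (intro sum.cong refl) (use adj_mat_pencil[OF A k] in auto)
  also have "\<dots> = op (pencil_det A) (Y k)" using k by simp
  finally show ?thesis by simp
qed

text \<open>
  The step in implicit rational form. The operator \<open>T\<close> stands for \<open>h L\<close>, and \<open>f j\<close> for \<open>h\<close> times the
  forcing at the \<open>j\<close>-th node.
\<close>

lemma scheme_step:
  assumes G: "gark_stages G s1 s2"
    and Y: "\<And>i. i < s1 \<Longrightarrow> Y i = u + (\<Sum>j<s1. complex_of_real (A11 G $$ (i, j)) \<cdot> T (Y j))
        + (\<Sum>j<s2. complex_of_real (A12 G $$ (i, j)) \<cdot> f j)"
    and u': "u' = u + (\<Sum>j<s1. complex_of_real (b1 G $ j) \<cdot> T (Y j))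
        + (\<Sum>j<s2. complex_of_real (b2 G $ j) \<cdot> f j)"
  shows "op (pencil_det (A11 G)) u' = op (stability_num G) u + (\<Sum>j<s2. op (forcing_num G j) (f j))"
proof -
  note c = gark_carriers[OF G]
  let ?Q = "pencil_det (A11 G)"
  let ?a = "adj_mat (pencil (A11 G))"
  define r where "r = (\<lambda>i. u + (\<Sum>j<s2. complex_of_real (A12 G $$ (i, j)) \<cdot> f j))"
  have QY: "op ?Q (Y k) = (\<Sum>i<s1. op (?a $$ (k, i)) (r i))" if "k < s1" for k
    by (rule stage_elimination[OF c(1) that]) (simp add: Y r_def algebra_simps)
  have "(\<Sum>k<s1. complex_of_real (b1 G $ k) \<cdot> op ?Q (Y k))
      = (\<Sum>k<s1. \<Sum>i<s1. complex_of_real (b1 G $ k) \<cdot> op (?a $$ (k, i)) u)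
      + (\<Sum>k<s1. \<Sum>i<s1. \<Sum>j<s2. complex_of_real (b1 G $ k * A12 G $$ (i, j)) \<cdot> op (?a $$ (k, i)) (f j))"
    by (simp add: QY r_def op_vec_add op_vec_sum op_vec_scale scale_sum_right scale_right_distrib sum.distrib)
  also have "(\<Sum>k<s1. \<Sum>i<s1. complex_of_real (b1 G $ k) \<cdot> op (?a $$ (k, i)) u)
      = op (resolvent_num (A11 G) (b1 G) (ones_vec s1)) u"
    using c by (simp add: op_resolvent_num ones_vec_def)
  also have "(\<Sum>k<s1. \<Sum>i<s1. \<Sum>j<s2. complex_of_real (b1 G $ k * A12 G $$ (i, j)) \<cdot> op (?a $$ (k, i)) (f j))
      = (\<Sum>j<s2. \<Sum>k<s1. \<Sum>i<s1. complex_of_real (b1 G $ k * A12 G $$ (i, j)) \<cdot> op (?a $$ (k, i)) (f j))"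
    by (subst (2) sum.swap, subst sum.swap) (rule refl)
  also have "\<dots> = (\<Sum>j<s2. op (resolvent_num (A11 G) (b1 G) (col (A12 G) j)) (f j))"
    using c by (simp add: op_resolvent_num)
  finally have "T (\<Sum>k<s1. complex_of_real (b1 G $ k) \<cdot> op ?Q (Y k))
      = T (op (resolvent_num (A11 G) (b1 G) (ones_vec s1)) u)
      + (\<Sum>j<s2. T (op (resolvent_num (A11 G) (b1 G) (col (A12 G) j)) (f j)))"
    by (simp add: T_add T_sum)
  then have "(\<Sum>k<s1. complex_of_real (b1 G $ k) \<cdot> T (op ?Q (Y k)))
      = T (op (resolvent_num (A11 G) (b1 G) (ones_vec s1)) u)
      + (\<Sum>j<s2. T (op (resolvent_num (A11 G) (b1 G) (col (A12 G) j)) (f j)))"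
    by (simp add: T_sum T_scale)
  then show ?thesis
    using c unfolding u'
    by (simp add: op_vec_add op_vec_sum op_vec_scale op_T stability_num_def forcing_num_def op_add
        op_pCons op_smult sum.distrib)
qed

end

context dissipative_operator
begin

text \<open>
  Here \<open>D k\<close> stands for \<open>h ^ k / k!\<close> times the \<open>k\<close>-th derivative of the solution at the start of the step.
  The remainders at the \<open>j\<close>-th node carry the powers of \<open>c\<^sub>j\<close> that Taylor's formula gives them. These
  powers have to stay with the numerators: at a node \<open>c\<^sub>j = 0\<close> with \<open>p > 0\<close> the hypothesis on
  \<open>W_tilde\<close> does not bound \<open>N\<^sub>j / Q\<close>, but there the remainders vanish.
\<close>

lemma one_step_error:
  fixes D :: "nat \<Rightarrow> 'v" and y f \<rho>0 \<rho>1 :: "nat \<Rightarrow> 'v" and K0 K1 :: "nat \<Rightarrow> real"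
  assumes G: "gark_stages G s1 s2" and stable: "A_stable (A11 G) (b1 G)"
    and order: "\<And>k l. k \<le> p \<Longrightarrow> l \<le> s1 + 1 \<Longrightarrow> w_coeff G k l = 0"
    and K0: "\<And>j z. j < s2 \<Longrightarrow> Re z \<le> 0 \<Longrightarrow>
      cmod (poly (smult (of_real (c2 G $ j ^ Suc p)) (pCons 0 (forcing_num G j))) z)
        \<le> K0 j * cmod (poly (pencil_det (A11 G)) z)"
    and K1: "\<And>j z. j < s2 \<Longrightarrow> Re z \<le> 0 \<Longrightarrow>
      cmod (poly (smult (of_real (c2 G $ j ^ p)) (forcing_num G j)) z)
        \<le> K1 j * cmod (poly (pencil_det (A11 G)) z)"
    and y_next: "y_next = (\<Sum>k\<le>p. D k) + \<rho>"
    and y: "\<And>j. j < s2 \<Longrightarrow> y j = (\<Sum>k\<le>p. complex_of_real (c2 G $ j ^ k) \<cdot> D k)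
        + complex_of_real (c2 G $ j ^ Suc p) \<cdot> \<rho>0 j"
    and f: "\<And>j. j < s2 \<Longrightarrow> f j = (\<Sum>k\<le>p. complex_of_real (real k * c2 G $ j ^ (k - 1)) \<cdot> D k)
        + complex_of_real (c2 G $ j ^ p) \<cdot> \<rho>1 j - T (y j)"
    and step: "op (pencil_det (A11 G)) u_next = op (stability_num G) u + (\<Sum>j<s2. op (forcing_num G j) (f j))"
    and \<rho>: "nrm \<rho> \<le> \<beta>" "\<And>j. j < s2 \<Longrightarrow> nrm (\<rho>0 j) \<le> \<beta>" "\<And>j. j < s2 \<Longrightarrow> nrm (\<rho>1 j) \<le> \<beta>"
  shows "nrm (y_next - u_next) \<le> nrm (D 0 - u) + (1 + (\<Sum>j<s2. \<bar>K0 j\<bar> + \<bar>K1 j\<bar>)) * \<beta>"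
proof -
  let ?Q = "pencil_det (A11 G)"
  let ?P = "stability_num G"
  let ?N = "forcing_num G"
  define N0 where "N0 = (\<lambda>j. smult (complex_of_real (c2 G $ j ^ Suc p)) (pCons 0 (?N j)))"
  define N1 where "N1 = (\<lambda>j. smult (complex_of_real (c2 G $ j ^ p)) (?N j))"
  have \<beta>: "0 \<le> \<beta>" using \<rho>(1) nrm_nonneg[of \<rho>] by linarith
  have inv: "invertible_mat (stage_mat (A11 G) z)" and stab: "cmod (stab_fun (A11 G) (b1 G) z) \<le> 1"
    if "Re z \<le> 0" for z
    using stable that by (auto simp: A_stable_def)
  have Q0: "poly ?Q z \<noteq> 0" if "Re z \<le> 0" for z
    using pencil_det_nonzero[OF gark_carriers(1)[OF G] inv[OF that]] .
  have P1: "cmod (poly ?P z) \<le> 1 * cmod (poly ?Q z)" if "Re z \<le> 0" for z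
    using poly_stability_num[OF G inv[OF that]] stab[OF that] by (simp add: norm_mult mult_left_le)
  have bij: "bij (op ?Q)" by (rule bij_op) (rule Q0)
  \<comment> \<open>\<open>solve\<close> is division by \<open>Q(T)\<close>\<close>
  define solve where "solve = inv_into UNIV (op ?Q)"
  have solve: "op ?Q (solve v) = v" for v
    unfolding solve_def by (rule surj_f_inv_f[OF bij_is_surj[OF bij]])
  \<comment> \<open>the order conditions: the scheme is exact on each Taylor term\<close>
  have moment: "op ?Q (D k) = (if k = 0 then op ?P (D 0) else 0)
      + (\<Sum>j<s2. op (?N j) (complex_of_real (real k * c2 G $ j ^ (k - 1)) \<cdot> D k
          - T (complex_of_real (c2 G $ j ^ k) \<cdot> D k)))" if k: "k \<le> p" for k
  proof (cases "k = 0")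
    case True
    have "?Q + pCons 0 (\<Sum>j<s2. ?N j) = ?P"
      by (rule consistency_condition_poly[OF G]) (simp add: order)
    then have "op ?P (D 0) = op (?Q + pCons 0 (\<Sum>j<s2. ?N j)) (D 0)" by simp
    then have "op ?P (D 0) = op ?Q (D 0) + (\<Sum>j<s2. op (?N j) (T (D 0)))"
      by (simp add: op_add op_pCons op_sum T_sum op_T)
    then show ?thesis using True by (simp add: op_vec_minus sum_negf)
  next
    case False
    have "op ?Q (D k) + (\<Sum>j<s2. op (?N j) (T (complex_of_real (c2 G $ j ^ k) \<cdot> D k)))
        = op (?Q + pCons 0 (\<Sum>j<s2. smult (complex_of_real (c2 G $ j ^ k)) (?N j))) (D k)"
      by (simp add: op_add op_pCons op_sum T_sum op_T op_smult T_scale op_vec_scale)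
    also have "\<dots> = op (smult (of_nat k) (\<Sum>j<s2. smult (complex_of_real (c2 G $ j ^ (k - 1))) (?N j))) (D k)"
      using False by (subst order_condition_poly[OF G _ order[OF k]]) auto
    also have "\<dots> = (\<Sum>j<s2. op (?N j) (complex_of_real (real k * c2 G $ j ^ (k - 1)) \<cdot> D k))"
      by (simp add: op_smult op_sum scale_sum_right op_vec_scale)
    finally show ?thesis using False by (simp add: op_vec_diff sum_subtractf algebra_simps)
  qed
  have Nf: "op (?N j) (f j) = (\<Sum>k\<le>p. op (?N j) (complex_of_real (real k * c2 G $ j ^ (k - 1)) \<cdot> D k
      - T (complex_of_real (c2 G $ j ^ k) \<cdot> D k))) - (op (N0 j) (\<rho>0 j) - op (N1 j) (\<rho>1 j))"
    if j: "j < s2" for j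
  proof -
    have fj: "f j = (\<Sum>k\<le>p. complex_of_real (real k * c2 G $ j ^ (k - 1)) \<cdot> D k - T (complex_of_real (c2 G $ j ^ k) \<cdot> D k))
        + complex_of_real (c2 G $ j ^ p) \<cdot> \<rho>1 j - complex_of_real (c2 G $ j ^ Suc p) \<cdot> T (\<rho>0 j)"
      unfolding f[OF j] y[OF j] by (simp only: T_add T_sum T_scale sum_subtractf) (simp add: algebra_simps)
    show ?thesis
      unfolding fj N0_def N1_def
      by (simp only: op_vec_add op_vec_diff op_vec_sum op_vec_scale op_smult op_pCons op_T scale_zero_left)
         (simp add: algebra_simps)
  qed
  have main: "op ?Q (y_next - u_next) = op ?P (D 0 - u) + op ?Q \<rho>
      + (\<Sum>j<s2. op (N0 j) (\<rho>0 j) - op (N1 j) (\<rho>1 j))"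
  proof -
    have "op ?Q y_next = op ?Q \<rho> + (\<Sum>k\<le>p. (if k = 0 then op ?P (D 0) else 0)
      + (\<Sum>j<s2. op (?N j) (complex_of_real (real k * c2 G $ j ^ (k - 1)) \<cdot> D k
          - T (complex_of_real (c2 G $ j ^ k) \<cdot> D k))))"
      unfolding y_next op_vec_add op_vec_sum by (simp add: moment)
    also have "\<dots> = op ?Q \<rho> + op ?P (D 0) + (\<Sum>j<s2. \<Sum>k\<le>p. op (?N j) (complex_of_real (real k * c2 G $ j ^ (k - 1)) \<cdot> D k
          - T (complex_of_real (c2 G $ j ^ k) \<cdot> D k)))"
      unfolding sum.distrib by (subst sum.swap) (simp add: add.assoc)
    also have "\<dots> = op ?Q \<rho> + op ?P (D 0) + (\<Sum>j<s2. op (?N j) (f j) + (op (N0 j) (\<rho>0 j) - op (N1 j) (\<rho>1 j)))"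
      by (simp add: Nf)
    finally show ?thesis unfolding op_vec_diff step sum.distrib by simp
  qed
  have "op ?Q (y_next - u_next) = op ?Q (op ?P (solve (D 0 - u)) + \<rho>
      + (\<Sum>j<s2. op (N0 j) (solve (\<rho>0 j)) - op (N1 j) (solve (\<rho>1 j))))"
  proof -
    have comm: "op ?Q (op R (solve v)) = op R v" for R v
      using op_mult[of ?Q R "solve v"] op_mult[of R ?Q "solve v"] by (simp add: mult.commute solve)
    show ?thesis by (subst main) (simp only: op_vec_add op_vec_sum op_vec_diff comm)
  qed
  then have eq: "y_next - u_next = op ?P (solve (D 0 - u)) + \<rho>
      + (\<Sum>j<s2. op (N0 j) (solve (\<rho>0 j)) - op (N1 j) (solve (\<rho>1 j)))"
    by (rule injD[OF bij_is_inj[OF bij]])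
  have bP: "nrm (op ?P (solve (D 0 - u))) \<le> nrm (D 0 - u)"
    using von_neumann_half_plane[of ?Q ?P 1 "solve (D 0 - u)"] Q0 P1 by (simp add: solve)
  have bN: "nrm (op (N0 j) (solve (\<rho>0 j)) - op (N1 j) (solve (\<rho>1 j))) \<le> (\<bar>K0 j\<bar> + \<bar>K1 j\<bar>) * \<beta>"
    if j: "j < s2" for j
  proof -
    have "nrm (op (N0 j) (solve (\<rho>0 j))) \<le> K0 j * nrm (\<rho>0 j)"
      using von_neumann_half_plane[of ?Q "N0 j" "K0 j" "solve (\<rho>0 j)"] Q0 K0[OF j] by (simp add: solve N0_def)
    moreover have "nrm (op (N1 j) (solve (\<rho>1 j))) \<le> K1 j * nrm (\<rho>1 j)"
      using von_neumann_half_plane[of ?Q "N1 j" "K1 j" "solve (\<rho>1 j)"] Q0 K1[OF j] by (simp add: solve N1_def)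
    moreover have "K0 j * nrm (\<rho>0 j) \<le> \<bar>K0 j\<bar> * \<beta>" "K1 j * nrm (\<rho>1 j) \<le> \<bar>K1 j\<bar> * \<beta>"
      using \<rho>(2,3)[OF j] by (auto intro!: mult_mono)
    ultimately show ?thesis
      using nrm_diff_triangle[of "op (N0 j) (solve (\<rho>0 j))" "op (N1 j) (solve (\<rho>1 j))"]
      by (simp add: distrib_right)
  qed
  have "nrm (y_next - u_next) \<le> nrm (op ?P (solve (D 0 - u))) + nrm \<rho>
      + nrm (\<Sum>j<s2. op (N0 j) (solve (\<rho>0 j)) - op (N1 j) (solve (\<rho>1 j)))"
    unfolding eq by (intro order_trans[OF nrm_triangle] add_mono nrm_triangle order_refl)
  also have "\<dots> \<le> nrm (D 0 - u) + \<beta> + (\<Sum>j<s2. (\<bar>K0 j\<bar> + \<bar>K1 j\<bar>) * \<beta>)"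
    by (intro add_mono bP \<rho>(1) order_trans[OF nrm_sum_le] sum_mono bN) simp
  also have "\<dots> = nrm (D 0 - u) + (1 + (\<Sum>j<s2. \<bar>K0 j\<bar> + \<bar>K1 j\<bar>)) * \<beta>"
    by (simp add: algebra_simps sum_distrib_left)
  finally show ?thesis .
qed

end

section \<open>Taylor expansion\<close>

context semi_inner_space
begin

lemma abs_Re_form_le: "\<bar>Re (form u v)\<bar> \<le> nrm u * nrm v"
  using Re_form_le[of u v] Re_form_le[of u "- v"] by (simp add: form_minus_right nrm_minus abs_le_iff)

text \<open>
  Derivatives are only required weakly, that is, after pairing with a fixed vector. Pairing with the
  remainder itself reduces the bound to the scalar case: the squared norm of the remainder is a
  scalar Taylor remainder.
\<close>

lemma weak_taylor:
  fixes D :: "nat \<Rightarrow> real \<Rightarrow> 'v"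
  assumes S: "convex S" and a: "a \<in> S" and b: "b \<in> S"
    and deriv: "\<And>v k t. k < n \<Longrightarrow> t \<in> S \<Longrightarrow>
      ((\<lambda>s. Re (form v (D k s))) has_field_derivative Re (form v (D (Suc k) t))) (at t within S)"
    and M: "\<And>t. t \<in> S \<Longrightarrow> nrm (D n t) \<le> M"
  shows "\<exists>\<rho>. nrm \<rho> \<le> M \<and>
    D 0 b = (\<Sum>k<n. complex_of_real ((b - a) ^ k / fact k) \<cdot> D k a) + complex_of_real ((b - a) ^ n) \<cdot> \<rho>"
proof (cases n)
  case 0
  then show ?thesis using M[OF b] by (intro exI[of _ "D 0 b"]) simp
next
  case (Suc m)
  have M0: "0 \<le> M" using M[OF a] nrm_nonneg[of "D n a"] by linarith
  define P where "P = (\<Sum>k<n. complex_of_real ((b - a) ^ k / fact k) \<cdot> D k a)"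
  define R where "R = D 0 b - P"
  have "norm (Re (form R (D 0 b)) - (\<Sum>i\<le>m. Re (form R (D i a)) * (b - a) ^ i / fact i))
      \<le> (nrm R * M) * norm (b - a) ^ Suc m / fact m"
  proof (rule field_Taylor[OF S _ _ a b])
    show "((\<lambda>s. Re (form R (D i s))) has_field_derivative Re (form R (D (Suc i) x))) (at x within S)"
      if "x \<in> S" "i \<le> m" for i x
      using that Suc by (intro deriv) auto
    show "norm (Re (form R (D (Suc m) x))) \<le> nrm R * M" if "x \<in> S" for x
      using abs_Re_form_le[of R "D n x"] M[OF that] mult_left_mono[OF M[OF that] nrm_nonneg[of R]]
      by (simp add: Suc)
  qed
  also have "(\<Sum>i\<le>m. Re (form R (D i a)) * (b - a) ^ i / fact i) = Re (form R P)"
  proof -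
    have Re_mult: "Re (complex_of_real x * z) = x * Re z" for x z by simp
    show ?thesis
      unfolding P_def Suc form_sum_right lessThan_Suc_atMost form_scale Re_sum Re_mult
      by (simp add: mult_ac)
  qed
  also have "Re (form R (D 0 b)) - Re (form R P) = (nrm R)\<^sup>2"
    unfolding nrm_power2 by (simp add: R_def form_diff_right)
  finally have "(nrm R)\<^sup>2 \<le> nrm R * M * \<bar>b - a\<bar> ^ n / fact m" by (simp add: Suc)
  also have "\<dots> \<le> nrm R * M * \<bar>b - a\<bar> ^ n"
    using divide_left_mono[of 1 "fact m" "nrm R * M * \<bar>b - a\<bar> ^ n"] M0 by (simp add: fact_ge_1)
  finally have R: "nrm R \<le> M * \<bar>b - a\<bar> ^ n"
    using M0 nrm_nonneg[of R]
    by (cases "nrm R = 0") (simp_all add: power2_eq_square mult.assoc less_le)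
  show ?thesis
  proof (cases "b = a")
    case True
    have "P = D 0 a"
      unfolding P_def Suc True by (subst sum.lessThan_Suc_shift) simp
    then show ?thesis unfolding P_def[symmetric] using True Suc M0 by (intro exI[of _ 0]) simp
  next
    case False
    define x where "x = (b - a) ^ n"
    have x: "x \<noteq> 0" "\<bar>x\<bar> = \<bar>b - a\<bar> ^ n" using False by (auto simp: x_def power_abs)
    have "nrm (complex_of_real (1 / x) \<cdot> R) \<le> M"
      using R x M0 by (simp add: nrm_scale norm_divide divide_le_eq)
    moreover have "D 0 b = P + complex_of_real x \<cdot> (complex_of_real (1 / x) \<cdot> R)"
      using x by (simp add: R_def)
    ultimately show ?thesis unfolding P_def x_def by blast
  qed
qed

end

section \<open>Error propagation\<close>

text \<open>
  On \<open>Re z \<le> \<mu>\<close> the quotient \<open>N\<^sub>j(z) (c\<^sub>j ^ (p + 1) z - (p + 1) c\<^sub>j ^ p) / Q(z)\<close> is bounded, so its numerator has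
  degree at most \<open>degree Q\<close>. For \<open>c\<^sub>j \<noteq> 0\<close> the bracket has degree one, which bounds the degrees of both
  \<open>z N\<^sub>j\<close> and \<open>N\<^sub>j\<close>. For \<open>c\<^sub>j = 0\<close> the bracket is \<open>-1\<close> if \<open>p = 0\<close>, which bounds \<open>N\<^sub>j\<close>, and otherwise both
  polynomials of the claim are zero.
\<close>

lemma forcing_num_bounds:
  assumes G: "gark_stages G s1 s2" and stable: "A_stable (A11 G) (b1 G)"
    and W: "W_tilde_bounded_on G (Suc p) {z. Re z \<le> \<mu>}" and j: "j < s2"
  shows "\<exists>K. \<forall>z. Re z \<le> 0 \<longrightarrow>
      cmod (poly (smult (of_real (c2 G $ j ^ Suc p)) (pCons 0 (forcing_num G j))) z)
        \<le> K * cmod (poly (pencil_det (A11 G)) z)"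
    and "\<exists>K. \<forall>z. Re z \<le> 0 \<longrightarrow>
      cmod (poly (smult (of_real (c2 G $ j ^ p)) (forcing_num G j)) z)
        \<le> K * cmod (poly (pencil_det (A11 G)) z)"
proof -
  let ?Q = "pencil_det (A11 G)"
  define c where "c = complex_of_real (c2 G $ j)"
  define l where "l = [: - (of_nat (Suc p) * c ^ p), c ^ Suc p :]"
  have Q: "poly ?Q z \<noteq> 0" if "Re z \<le> 0" for z
    using pencil_det_nonzero[OF gark_carriers(1)[OF G]] stable that by (auto simp: A_stable_def)
  obtain B where inv: "\<And>z. Re z \<le> \<mu> \<Longrightarrow> invertible_mat (stage_mat (A11 G) z)"
    and B: "\<And>z. Re z \<le> \<mu> \<Longrightarrow> cmod (W_tilde G (Suc p) z $$ (0, j)) \<le> B"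
    using W j gark_carriers(5)[OF G] by (auto simp: W_tilde_bounded_on_def)
  have deg: "degree (forcing_num G j * l) \<le> degree ?Q"
  proof (rule degree_le_of_bounded)
    fix x :: real assume x: "x \<le> \<mu>"
    define z where "z = complex_of_real x"
    have z: "Re z \<le> \<mu>" using x by (simp add: z_def)
    have "poly (forcing_num G j * l) z = poly ?Q z * W_tilde G (Suc p) z $$ (0, j)"
      using poly_forcing_num[OF G inv[OF z] j, of "Suc p"] by (simp add: l_def c_def algebra_simps)
    then have "cmod (poly (forcing_num G j * l) z) = cmod (W_tilde G (Suc p) z $$ (0, j)) * cmod (poly ?Q z)"
      by (simp add: norm_mult mult.commute)
    also have "\<dots> \<le> B * cmod (poly ?Q z)" by (intro mult_right_mono B z) simp
    finally show "cmod (poly (forcing_num G j * l) (of_real x)) \<le> B * cmod (poly ?Q (of_real x))"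
      by (simp add: z_def)
  qed
  have "degree (smult (c ^ Suc p) (pCons 0 (forcing_num G j))) \<le> degree ?Q
      \<and> degree (smult (c ^ p) (forcing_num G j)) \<le> degree ?Q"
  proof (cases "c = 0")
    case True
    show ?thesis
    proof (cases "p = 0")
      case True
      then show ?thesis using \<open>c = 0\<close> deg by (simp add: l_def)
    next
      case False
      then show ?thesis using \<open>c = 0\<close> by (simp add: power_0_left)
    qed
  next
    case False
    show ?thesis
    proof (cases "forcing_num G j = 0")
      case True
      then show ?thesis by simp
    next
      case 2: False
      have "degree l = 1" using False by (simp add: l_def)
      then have "degree (forcing_num G j * l) = Suc (degree (forcing_num G j))"
        using 2 False by (subst degree_mult_eq) (auto simp: l_def)
      then show ?thesis using deg 2 False by simp
    qed
  qed
  then show "\<exists>K. \<forall>z. Re z \<le> 0 \<longrightarrow>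
      cmod (poly (smult (of_real (c2 G $ j ^ Suc p)) (pCons 0 (forcing_num G j))) z)
        \<le> K * cmod (poly (pencil_det (A11 G)) z)"
    "\<exists>K. \<forall>z. Re z \<le> 0 \<longrightarrow>
      cmod (poly (smult (of_real (c2 G $ j ^ p)) (forcing_num G j)) z)
        \<le> K * cmod (poly (pencil_det (A11 G)) z)"
    using bounded_of_degree_le[OF Q] unfolding c_def of_real_power[symmetric] by blast+
qed

context dissipative_operator
begin

text \<open>
  \<open>y k\<close> is the \<open>k\<close>-th derivative of the solution. The three expansions feed \<open>one_step_error\<close>; the one of
  \<open>h y'\<close> at a node is shifted by one index, which produces the factors \<open>k c\<^sub>j ^ (k - 1)\<close>.
\<close>

lemma smooth_step_error:
  fixes y :: "nat \<Rightarrow> real \<Rightarrow> 'v" and K0 K1 :: "nat \<Rightarrow> real"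
  assumes G: "gark_stages G s1 s2" and stable: "A_stable (A11 G) (b1 G)"
    and order: "\<And>k l. k \<le> p \<Longrightarrow> l \<le> s1 + 1 \<Longrightarrow> w_coeff G k l = 0"
    and K0: "\<And>j z. j < s2 \<Longrightarrow> Re z \<le> 0 \<Longrightarrow>
      cmod (poly (smult (of_real (c2 G $ j ^ Suc p)) (pCons 0 (forcing_num G j))) z)
        \<le> K0 j * cmod (poly (pencil_det (A11 G)) z)"
    and K1: "\<And>j z. j < s2 \<Longrightarrow> Re z \<le> 0 \<Longrightarrow>
      cmod (poly (smult (of_real (c2 G $ j ^ p)) (forcing_num G j)) z)
        \<le> K1 j * cmod (poly (pencil_det (A11 G)) z)"
    and S: "convex S" "t \<in> S" "t + h \<in> S" "\<And>j. j < s2 \<Longrightarrow> t + c2 G $ j * h \<in> S"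
    and deriv: "\<And>v k t. k \<le> p \<Longrightarrow> t \<in> S \<Longrightarrow>
      ((\<lambda>s. Re (form v (y k s))) has_field_derivative Re (form v (y (Suc k) t))) (at t within S)"
    and M: "\<And>t. t \<in> S \<Longrightarrow> nrm (y (Suc p) t) \<le> M"
    and h: "0 < h"
    and f: "\<And>j. j < s2 \<Longrightarrow> f j = complex_of_real h \<cdot> y 1 (t + c2 G $ j * h) - T (y 0 (t + c2 G $ j * h))"
    and step: "op (pencil_det (A11 G)) u_next = op (stability_num G) u + (\<Sum>j<s2. op (forcing_num G j) (f j))"
  shows "nrm (y 0 (t + h) - u_next)
    \<le> nrm (y 0 t - u) + (1 + (\<Sum>j<s2. \<bar>K0 j\<bar> + \<bar>K1 j\<bar>)) * (h ^ Suc p * M)"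
proof -
  have expand: "\<exists>\<rho>. nrm \<rho> \<le> M \<and> y 0 (t + x) = (\<Sum>k<Suc p. complex_of_real (x ^ k / fact k) \<cdot> y k t)
      + complex_of_real (x ^ Suc p) \<cdot> \<rho>" if "t + x \<in> S" for x
    using weak_taylor[OF S(1,2) that, where n = "Suc p" and D = y, OF deriv M] by simp
  have expand': "\<exists>\<rho>. nrm \<rho> \<le> M \<and> y 1 (t + x) = (\<Sum>k<p. complex_of_real (x ^ k / fact k) \<cdot> y (Suc k) t)
      + complex_of_real (x ^ p) \<cdot> \<rho>" if "t + x \<in> S" for x
    using weak_taylor[OF S(1,2) that, where n = p and D = "\<lambda>k. y (Suc k)", OF deriv M] by simp
  define D where "D = (\<lambda>k. complex_of_real (h ^ k / fact k) \<cdot> y k t)"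
  obtain \<rho> where \<rho>: "nrm \<rho> \<le> M" and y\<rho>: "y 0 (t + h) = (\<Sum>k<Suc p. complex_of_real (h ^ k / fact k) \<cdot> y k t)
      + complex_of_real (h ^ Suc p) \<cdot> \<rho>"
    using expand[OF S(3)] by blast
  have "\<exists>\<rho>0. \<forall>j\<in>{..<s2}. nrm (\<rho>0 j) \<le> M \<and> y 0 (t + c2 G $ j * h)
        = (\<Sum>k<Suc p. complex_of_real ((c2 G $ j * h) ^ k / fact k) \<cdot> y k t)
          + complex_of_real ((c2 G $ j * h) ^ Suc p) \<cdot> \<rho>0 j"
    by (rule bchoice) (use expand[OF S(4)] in simp)
  then obtain \<rho>0 where \<rho>0: "\<And>j. j < s2 \<Longrightarrow> nrm (\<rho>0 j) \<le> M"
    and y\<rho>0: "\<And>j. j < s2 \<Longrightarrow> y 0 (t + c2 G $ j * h)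
        = (\<Sum>k<Suc p. complex_of_real ((c2 G $ j * h) ^ k / fact k) \<cdot> y k t)
          + complex_of_real ((c2 G $ j * h) ^ Suc p) \<cdot> \<rho>0 j"
    by auto
  have "\<exists>\<rho>1. \<forall>j\<in>{..<s2}. nrm (\<rho>1 j) \<le> M \<and> y 1 (t + c2 G $ j * h)
        = (\<Sum>k<p. complex_of_real ((c2 G $ j * h) ^ k / fact k) \<cdot> y (Suc k) t)
          + complex_of_real ((c2 G $ j * h) ^ p) \<cdot> \<rho>1 j"
    by (rule bchoice) (use expand'[OF S(4)] in simp)
  then obtain \<rho>1 where \<rho>1: "\<And>j. j < s2 \<Longrightarrow> nrm (\<rho>1 j) \<le> M"
    and y\<rho>1: "\<And>j. j < s2 \<Longrightarrow> y 1 (t + c2 G $ j * h)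
        = (\<Sum>k<p. complex_of_real ((c2 G $ j * h) ^ k / fact k) \<cdot> y (Suc k) t)
          + complex_of_real ((c2 G $ j * h) ^ p) \<cdot> \<rho>1 j"
    by auto
  let ?H = "complex_of_real (h ^ Suc p)"
  have H: "nrm (?H \<cdot> v) \<le> h ^ Suc p * M" if "nrm v \<le> M" for v
    using that h by (simp add: nrm_scale norm_mult norm_power)
  have "nrm (y 0 (t + h) - u_next)
      \<le> nrm (D 0 - u) + (1 + (\<Sum>j<s2. \<bar>K0 j\<bar> + \<bar>K1 j\<bar>)) * (h ^ Suc p * M)"
  proof (rule one_step_error[where p = p and D = D and f = f and u = u and \<rho> = "?H \<cdot> \<rho>"
        and ?\<rho>0.0 = "\<lambda>j. ?H \<cdot> \<rho>0 j" and ?\<rho>1.0 = "\<lambda>j. ?H \<cdot> \<rho>1 j"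
        and y = "\<lambda>j. y 0 (t + c2 G $ j * h)"])
    show "y 0 (t + h) = (\<Sum>k\<le>p. D k) + ?H \<cdot> \<rho>"
      unfolding y\<rho> D_def lessThan_Suc_atMost ..
    fix j assume j: "j < s2"
    show "y 0 (t + c2 G $ j * h) = (\<Sum>k\<le>p. complex_of_real (c2 G $ j ^ k) \<cdot> D k)
        + complex_of_real (c2 G $ j ^ Suc p) \<cdot> ?H \<cdot> \<rho>0 j"
      unfolding y\<rho>0[OF j] D_def lessThan_Suc_atMost scale_scale of_real_mult[symmetric]
      by (simp add: power_mult_distrib mult_ac)
    have "complex_of_real h \<cdot> y 1 (t + c2 G $ j * h)
        = (\<Sum>k<p. complex_of_real (c2 G $ j ^ k * h ^ Suc k / fact k) \<cdot> y (Suc k) t)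
          + complex_of_real (c2 G $ j ^ p) \<cdot> ?H \<cdot> \<rho>1 j"
      unfolding y\<rho>1[OF j] scale_right_distrib scale_sum_right scale_scale of_real_mult[symmetric]
      by (simp add: power_mult_distrib mult_ac)
    also have "(\<Sum>k<p. complex_of_real (c2 G $ j ^ k * h ^ Suc k / fact k) \<cdot> y (Suc k) t)
        = (\<Sum>k<p. complex_of_real (real (Suc k) * c2 G $ j ^ (Suc k - 1)) \<cdot> D (Suc k))"
    proof (intro sum.cong refl)
      fix k
      have "c2 G $ j ^ k * h ^ Suc k / fact k = real (Suc k) * c2 G $ j ^ (Suc k - 1) * (h ^ Suc k / fact (Suc k))"
        by simp
      then show "complex_of_real (c2 G $ j ^ k * h ^ Suc k / fact k) \<cdot> y (Suc k) t
          = complex_of_real (real (Suc k) * c2 G $ j ^ (Suc k - 1)) \<cdot> D (Suc k)"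
        unfolding D_def scale_scale of_real_mult[symmetric] by simp
    qed
    also have "\<dots> = (\<Sum>k<Suc p. complex_of_real (real k * c2 G $ j ^ (k - 1)) \<cdot> D k)"
      unfolding sum.lessThan_Suc_shift by simp
    finally show "f j = (\<Sum>k\<le>p. complex_of_real (real k * c2 G $ j ^ (k - 1)) \<cdot> D k)
        + complex_of_real (c2 G $ j ^ p) \<cdot> ?H \<cdot> \<rho>1 j - T (y 0 (t + c2 G $ j * h))"
      unfolding f[OF j] lessThan_Suc_atMost by simp
    show "nrm (?H \<cdot> \<rho>0 j) \<le> h ^ Suc p * M" "nrm (?H \<cdot> \<rho>1 j) \<le> h ^ Suc p * M"
      by (rule H[OF \<rho>0[OF j]] H[OF \<rho>1[OF j]])+
  next
    show "nrm (?H \<cdot> \<rho>) \<le> h ^ Suc p * M" using \<rho> by (rule H)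
  qed (fact G stable step order K0 K1)+
  then show ?thesis by (simp add: D_def)
qed

end

section \<open>Coordinate vectors as functions\<close>

text \<open>
  A vector of \<open>\<complex>\<^sup>d\<close> is represented by a function on \<open>\<nat>\<close>. These functions form a type that does not depend
  on \<open>d\<close>, so the theory above can be instantiated for every dimension. Values from index \<open>d\<close> on
  have norm zero and are mapped to zero by the operator.
\<close>

definition coord_scale :: "complex \<Rightarrow> (nat \<Rightarrow> complex) \<Rightarrow> nat \<Rightarrow> complex" where
  "coord_scale a v = (\<lambda>i. a * v i)"

definition coord_form :: "nat \<Rightarrow> (complex vec \<Rightarrow> complex vec \<Rightarrow> complex) \<Rightarrow>
    (nat \<Rightarrow> complex) \<Rightarrow> (nat \<Rightarrow> complex) \<Rightarrow> complex" where
  "coord_form d ip u v = ip (vec d u) (vec d v)"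

definition coord_op :: "nat \<Rightarrow> complex mat \<Rightarrow> (nat \<Rightarrow> complex) \<Rightarrow> nat \<Rightarrow> complex" where
  "coord_op d Z v = (\<lambda>i. if i < d then (Z *\<^sub>v vec d v) $ i else 0)"

definition coords :: "nat \<Rightarrow> complex vec \<Rightarrow> nat \<Rightarrow> complex" where
  "coords d v = (\<lambda>i. if i < d then v $ i else 0)"

lemma sum_fun_apply: "(\<Sum>i\<in>I. f i) x = (\<Sum>i\<in>I. f i x)"
  by (induction I rule: infinite_finite_induct) simp_all

lemma smult_mult_mat_vec:
  fixes a :: "'a :: comm_semiring_0"
  assumes "A \<in> carrier_mat m n" "v \<in> carrier_vec n"
  shows "(a \<cdot>\<^sub>m A) *\<^sub>v v = a \<cdot>\<^sub>v (A *\<^sub>v v)"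
  using assms by (intro eq_vecI) (auto simp: scalar_prod_def sum_distrib_left mult_ac)

lemma vec_fun_add: "vec d (u + v) = vec d u + vec d v"
  by (intro eq_vecI) auto

lemma vec_coord_scale: "vec d (coord_scale a v) = a \<cdot>\<^sub>v vec d v"
  by (intro eq_vecI) (auto simp: coord_scale_def)

lemma vec_coords: "v \<in> carrier_vec d \<Longrightarrow> vec d (coords d v) = v"
  by (intro eq_vecI) (auto simp: coords_def)

lemma vec_coord_op: "Z \<in> carrier_mat d d \<Longrightarrow> vec d (coord_op d Z v) = Z *\<^sub>v vec d v"
  by (intro eq_vecI) (auto simp: coord_op_def)

lemma coord_op_coords:
  "v \<in> carrier_vec d \<Longrightarrow> coord_op d Z (coords d v) = (\<lambda>i. if i < d then (Z *\<^sub>v v) $ i else 0)"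
  unfolding coord_op_def by (subst vec_coords) simp_all

lemma inner_productD:
  assumes "inner_product d ip" "u \<in> carrier_vec d" "v \<in> carrier_vec d"
  shows "w \<in> carrier_vec d \<Longrightarrow> ip u (v + w) = ip u v + ip u w"
    and "ip u (a \<cdot>\<^sub>v v) = a * ip u v"
    and "ip u v = cnj (ip v u)"
    and "u \<noteq> 0\<^sub>v d \<Longrightarrow> 0 < Re (ip u u)"
  using assms unfolding inner_product_def by blast+

lemma inner_product_nonneg:
  assumes "inner_product d ip" "v \<in> carrier_vec d"
  shows "0 \<le> Re (ip v v)"
proof (cases "v = 0\<^sub>v d")
  case True
  have "ip v (0 \<cdot>\<^sub>v v) = 0 * ip v v" by (rule inner_productD(2)[OF assms(1,2,2)])
  moreover have "0 \<cdot>\<^sub>v v = v" using True by auto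
  ultimately show ?thesis by simp
next
  case False
  then show ?thesis using inner_productD(4)[OF assms(1,2,2)] by simp
qed

lemma coord_semi_inner_space:
  assumes ip: "inner_product d ip"
  shows "semi_inner_space coord_scale (coord_form d ip)"
proof unfold_locales
  fix a b :: complex and u v w :: "nat \<Rightarrow> complex"
  show "coord_scale a (u + v) = coord_scale a u + coord_scale a v"
    "coord_scale (a + b) u = coord_scale a u + coord_scale b u"
    "coord_scale a (coord_scale b u) = coord_scale (a * b) u"
    "coord_scale 1 u = u"
    by (auto simp: coord_scale_def fun_eq_iff algebra_simps)
  show "coord_form d ip u (v + w) = coord_form d ip u v + coord_form d ip u w"
    unfolding coord_form_def vec_fun_add by (rule inner_productD(1)[OF ip]) simp_all
  show "coord_form d ip u (coord_scale a v) = a * coord_form d ip u v"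
    unfolding coord_form_def vec_coord_scale by (rule inner_productD(2)[OF ip]) simp_all
  show "coord_form d ip u v = cnj (coord_form d ip v u)"
    unfolding coord_form_def by (rule inner_productD(3)[OF ip]) simp_all
  show "0 \<le> Re (coord_form d ip v v)"
    unfolding coord_form_def by (rule inner_product_nonneg[OF ip]) simp
qed

text \<open>
  An eigenvalue of a dissipative matrix lies in the closed left half-plane.
\<close>

lemma resolvent_nonsingular:
  fixes Z :: "complex mat"
  assumes ip: "inner_product d ip" and Z: "Z \<in> carrier_mat d d"
    and dissip: "\<And>v. v \<in> carrier_vec d \<Longrightarrow> Re (ip v (Z *\<^sub>v v)) \<le> 0" and \<rho>: "0 < Re \<rho>"
  shows "Determinant.det (\<rho> \<cdot>\<^sub>m 1\<^sub>m d - Z) \<noteq> 0"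
proof
  let ?M = "\<rho> \<cdot>\<^sub>m 1\<^sub>m d - Z"
  have M: "?M \<in> carrier_mat d d" using Z by auto
  assume "Determinant.det ?M = 0"
  then obtain v where v: "v \<in> carrier_vec d" "v \<noteq> 0\<^sub>v d" "?M *\<^sub>v v = 0\<^sub>v d"
    using det_0_iff_vec_prod_zero_field[OF M] by blast
  have Mv: "?M *\<^sub>v v = \<rho> \<cdot>\<^sub>v v - Z *\<^sub>v v"
    using v(1) Z by (simp add: minus_mult_distrib_mat_vec[of _ d d] smult_mult_mat_vec[of _ d d])
  have "Z *\<^sub>v v = \<rho> \<cdot>\<^sub>v v"
  proof (intro eq_vecI)
    fix i assume "i < dim_vec (\<rho> \<cdot>\<^sub>v v)"
    then have i: "i < d" using v(1) by simp
    have "(\<rho> \<cdot>\<^sub>v v - Z *\<^sub>v v) $ i = 0" using i v(3) Mv by simp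
    then show "(Z *\<^sub>v v) $ i = (\<rho> \<cdot>\<^sub>v v) $ i" using i v(1) Z by simp
  qed (use v(1) Z in auto)
  then have "ip v (Z *\<^sub>v v) = \<rho> * ip v v"
    using inner_productD(2)[OF ip v(1) v(1)] by simp
  moreover have "Im (ip v v) = 0"
  proof -
    have "Im (ip v v) = Im (cnj (ip v v))"
      using inner_productD(3)[OF ip v(1) v(1)] by (rule arg_cong)
    then show ?thesis by simp
  qed
  moreover have "0 < Re (ip v v)" by (rule inner_productD(4)[OF ip v(1,1,2)])
  ultimately have "0 < Re (ip v (Z *\<^sub>v v))" using \<rho> by simp
  then show False using dissip[OF v(1)] by simp
qed

text \<open>
  From index \<open>d\<close> on, \<open>\<rho> - Z\<close> is multiplication by \<open>\<rho>\<close>, so it remains bijective on the larger space.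
\<close>

lemma coord_dissipative_operator:
  assumes ip: "inner_product d ip" and Z: "Z \<in> carrier_mat d d"
    and dissip: "\<And>v. v \<in> carrier_vec d \<Longrightarrow> Re (ip v (Z *\<^sub>v v)) \<le> 0"
  shows "dissipative_operator coord_scale (coord_form d ip) (coord_op d Z)"
proof -
  interpret semi_inner_space coord_scale "coord_form d ip" by (rule coord_semi_inner_space[OF ip])
  show ?thesis
  proof unfold_locales
    fix u v :: "nat \<Rightarrow> complex" and a \<rho> :: complex
    have "Z *\<^sub>v vec d (u + v) = Z *\<^sub>v vec d u + Z *\<^sub>v vec d v"
      unfolding vec_fun_add using Z by (simp add: mult_add_distrib_mat_vec[of _ d d])
    then show "coord_op d Z (u + v) = coord_op d Z u + coord_op d Z v"
      using Z by (auto simp: coord_op_def fun_eq_iff)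
    have "Z *\<^sub>v vec d (coord_scale a v) = a \<cdot>\<^sub>v (Z *\<^sub>v vec d v)"
      unfolding vec_coord_scale using Z by (simp add: mult_mat_vec[of _ d d])
    then show "coord_op d Z (coord_scale a v) = coord_scale a (coord_op d Z v)"
      using Z by (auto simp: coord_op_def coord_scale_def fun_eq_iff)
    show "Re (coord_form d ip v (coord_op d Z v)) \<le> 0"
      unfolding coord_form_def vec_coord_op[OF Z] by (rule dissip) simp
    assume \<rho>: "0 < Re \<rho>"
    let ?M = "\<rho> \<cdot>\<^sub>m 1\<^sub>m d - Z"
    have M: "?M \<in> carrier_mat d d" using Z by auto
    have "?M \<in> Units (ring_mat TYPE(complex) d ())"
      by (rule det_non_zero_imp_unit[OF M resolvent_nonsingular[OF ip Z dissip \<rho>]])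
    then obtain B where B: "B \<in> carrier_mat d d" "B * ?M = 1\<^sub>m d" "?M * B = 1\<^sub>m d"
      unfolding Units_def by (auto simp: ring_mat_simps)
    have Mv: "?M *\<^sub>v vec d v = vec d (coord_scale \<rho> v - coord_op d Z v)" for v
      using Z by (intro eq_vecI)
        (auto simp: minus_mult_distrib_mat_vec[of _ d d] smult_mult_mat_vec[of _ d d] coord_op_def coord_scale_def)
    define R where "R = (\<lambda>v i. if i < d then (B *\<^sub>v vec d v) $ i else v i / \<rho>)"
    have R: "vec d (R v) = B *\<^sub>v vec d v" for v
      using B by (intro eq_vecI) (auto simp: R_def)
    have \<rho>0: "\<rho> \<noteq> 0" using \<rho> by auto
    show "bij (\<lambda>v. coord_scale \<rho> v - coord_op d Z v)"
    proof (rule bij_betw_byWitness[where f' = R])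
      have "R (coord_scale \<rho> v - coord_op d Z v) i = v i" for v i
      proof (cases "i < d")
        case True
        have "B *\<^sub>v vec d (coord_scale \<rho> v - coord_op d Z v) = (B * ?M) *\<^sub>v vec d v"
          unfolding Mv[symmetric] by (rule assoc_mult_mat_vec[OF B(1) M, symmetric]) simp
        then show ?thesis using True B by (simp add: R_def)
      next
        case False
        then show ?thesis using \<rho>0 by (simp add: R_def coord_scale_def coord_op_def)
      qed
      then show "\<forall>v\<in>UNIV. R (coord_scale \<rho> v - coord_op d Z v) = v" by auto
      have "(coord_scale \<rho> (R v) - coord_op d Z (R v)) i = v i" for v i
      proof (cases "i < d")
        case True
        have "vec d (coord_scale \<rho> (R v) - coord_op d Z (R v)) = ?M *\<^sub>v (B *\<^sub>v vec d v)"
          by (simp add: Mv[symmetric] R)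
        also have "\<dots> = (?M * B) *\<^sub>v vec d v"
          by (rule assoc_mult_mat_vec[OF M B(1), symmetric]) simp
        also have "\<dots> = vec d v" using B by simp
        finally have "vec d (coord_scale \<rho> (R v) - coord_op d Z (R v)) $ i = vec d v $ i" by simp
        then show ?thesis using True by simp
      next
        case False
        then show ?thesis using \<rho>0 by (simp add: R_def coord_scale_def coord_op_def)
      qed
      then show "\<forall>v\<in>UNIV. coord_scale \<rho> (R v) - coord_op d Z (R v) = v" by (auto simp: fun_eq_iff)
    qed auto
  qed
qed

section \<open>Regularity of the solution\<close>

text \<open>
  The differential equation lifts the \<open>p\<close> derivatives of \<open>g\<close> to \<open>p + 1\<close> derivatives of \<open>y\<close>. The interval must
  not be a point, for otherwise derivatives within it are not unique.
\<close>

lemma ode_derivatives: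
  fixes y g :: "real \<Rightarrow> complex vec"
  assumes ab: "a < b" and L: "L \<in> carrier_mat d d"
    and ode: "solves_linear_ode d L g y {a..b}"
    and carr: "\<forall>t\<in>{a..b}. g t \<in> carrier_vec d"
    and g: "vec_times_differentiable_on d p g {a..b}"
    and k: "k \<le> p" and i: "i < d" and t: "t \<in> {a..b}"
  shows "(nderiv_within {a..b} k (\<lambda>u. y u $ i) has_vector_derivative
           nderiv_within {a..b} (Suc k) (\<lambda>u. y u $ i) t) (at t within {a..b})"
    and "nderiv_within {a..b} (Suc k) (\<lambda>u. y u $ i) t
      = (\<Sum>j<d. L $$ (i, j) * nderiv_within {a..b} k (\<lambda>u. y u $ j) t)
        + nderiv_within {a..b} k (\<lambda>u. g u $ i) t"
proof -
  let ?y = "\<lambda>k i. nderiv_within {a..b} k (\<lambda>u. y u $ i)"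
  let ?g = "\<lambda>k i. nderiv_within {a..b} k (\<lambda>u. g u $ i)"
  have unique: "vector_derivative f (at t within {a..b}) = f'"
    if "(f has_vector_derivative f') (at t within {a..b})" "t \<in> {a..b}" for f :: "real \<Rightarrow> complex" and f' t
    using that ab by (intro vector_derivative_within_closed_interval) auto
  have "\<forall>t\<in>{a..b}. \<forall>i<d. (?y k i has_vector_derivative ?y (Suc k) i t) (at t within {a..b})
      \<and> ?y (Suc k) i t = (\<Sum>j<d. L $$ (i, j) * ?y k j t) + ?g k i t"
    using k
  proof (induction k)
    case 0
    show ?case
    proof (intro ballI allI impI)
      fix t i assume t: "t \<in> {a..b}" and i: "i < d"
      have yt: "y t \<in> carrier_vec d"
        and der: "((\<lambda>u. y u $ i) has_vector_derivative (L *\<^sub>v y t + g t) $ i) (at t within {a..b})"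
        using ode t i by (auto simp: solves_linear_ode_def)
      have "(L *\<^sub>v y t + g t) $ i = (\<Sum>j<d. L $$ (i, j) * y t $ j) + g t $ i"
        using L yt bspec[OF carr t] i by (auto simp: scalar_prod_def atLeast0LessThan intro!: sum.cong)
      then show "(?y 0 i has_vector_derivative ?y (Suc 0) i t) (at t within {a..b})
          \<and> ?y (Suc 0) i t = (\<Sum>j<d. L $$ (i, j) * ?y 0 j t) + ?g 0 i t"
        using der unique[OF der t] by simp
    qed
  next
    case (Suc k)
    show ?case
    proof (intro ballI allI impI)
      fix t i assume t: "t \<in> {a..b}" and i: "i < d"
      have IH0: "\<forall>t\<in>{a..b}. \<forall>i<d. (?y k i has_vector_derivative ?y (Suc k) i t) (at t within {a..b})
          \<and> ?y (Suc k) i t = (\<Sum>j<d. L $$ (i, j) * ?y k j t) + ?g k i t"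
        by (rule Suc.IH) (use Suc.prems in simp)
      have IH: "\<And>t i. t \<in> {a..b} \<Longrightarrow> i < d \<Longrightarrow> (?y k i has_vector_derivative ?y (Suc k) i t) (at t within {a..b})"
        "\<And>t i. t \<in> {a..b} \<Longrightarrow> i < d \<Longrightarrow> ?y (Suc k) i t = (\<Sum>j<d. L $$ (i, j) * ?y k j t) + ?g k i t"
        using IH0 by blast+
      have "?g k i differentiable (at t within {a..b})"
        using g Suc.prems i t by (auto simp: vec_times_differentiable_on_def times_differentiable_on_def)
      then have "(?g k i has_vector_derivative ?g (Suc k) i t) (at t within {a..b})"
        by (simp add: vector_derivative_works)
      then have "((\<lambda>t. (\<Sum>j<d. L $$ (i, j) * ?y k j t) + ?g k i t) has_vector_derivative
          (\<Sum>j<d. L $$ (i, j) * ?y (Suc k) j t) + ?g (Suc k) i t) (at t within {a..b})"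
        by (intro has_vector_derivative_add has_vector_derivative_sum has_vector_derivative_mult_right IH(1) t)
           auto
      then have der: "(?y (Suc k) i has_vector_derivative
          (\<Sum>j<d. L $$ (i, j) * ?y (Suc k) j t) + ?g (Suc k) i t) (at t within {a..b})"
        by (rule has_vector_derivative_transform[OF t, rotated]) (rule IH(2)[OF _ i])
      then show "(?y (Suc k) i has_vector_derivative ?y (Suc (Suc k)) i t) (at t within {a..b})
          \<and> ?y (Suc (Suc k)) i t = (\<Sum>j<d. L $$ (i, j) * ?y (Suc k) j t) + ?g (Suc k) i t"
        using unique[OF der t] by (simp only: nderiv_within.simps(2)[of _ "Suc k"])
    qed
  qed
  then show "(?y k i has_vector_derivative ?y (Suc k) i t) (at t within {a..b})"
    "?y (Suc k) i t = (\<Sum>j<d. L $$ (i, j) * ?y k j t) + ?g k i t"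
    using i t by blast+
qed

lemma coord_form_has_derivative:
  assumes ip: "inner_product d ip"
    and D: "\<And>i. i < d \<Longrightarrow> ((\<lambda>s. w s i) has_vector_derivative w' i) (at t within S)"
  shows "((\<lambda>s. Re (coord_form d ip v (w s))) has_field_derivative Re (coord_form d ip v w')) (at t within S)"
proof -
  interpret semi_inner_space coord_scale "coord_form d ip" by (rule coord_semi_inner_space[OF ip])
  define e where "e = (\<lambda>j i::nat. if i = j then 1 else 0 :: complex)"
  have expand: "coord_form d ip v x = (\<Sum>j<d. coord_form d ip v (e j) * x j)" for x
  proof -
    have "vec d x = vec d (\<Sum>j<d. coord_scale (x j) (e j))"
      by (intro eq_vecI) (auto simp: sum_fun_apply coord_scale_def e_def if_distrib[of "\<lambda>y. _ * y"] cong: if_cong)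
    then have "coord_form d ip v x = coord_form d ip v (\<Sum>j<d. coord_scale (x j) (e j))"
      by (simp add: coord_form_def)
    then show ?thesis by (simp add: form_sum_right form_scale mult.commute)
  qed
  have "((\<lambda>s. \<Sum>j<d. coord_form d ip v (e j) * w s j) has_vector_derivative
      (\<Sum>j<d. coord_form d ip v (e j) * w' j)) (at t within S)"
    by (intro has_vector_derivative_sum has_vector_derivative_mult_right D) simp
  then have "((\<lambda>s. Re (\<Sum>j<d. coord_form d ip v (e j) * w s j)) has_vector_derivative
      Re (\<Sum>j<d. coord_form d ip v (e j) * w' j)) (at t within S)"
    by (rule bounded_linear.has_vector_derivative[OF bounded_linear_Re])
  then show ?thesis unfolding expand[symmetric] has_real_derivative_iff_has_vector_derivative .
qed

section \<open>The global error\<close>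

lemma vec_lincomb_index: "r < d \<Longrightarrow> vec_lincomb d s a V $ r = (\<Sum>j<s. complex_of_real (a j) * V j $ r)"
  by (simp add: vec_lincomb_def)

lemma vec_lincomb_carrier [simp]: "vec_lincomb d s a V \<in> carrier_vec d"
  by (simp add: vec_lincomb_def)

lemma gark_step_carrier:
  assumes "gark_step G d L g h t u u'"
  shows "u' \<in> carrier_vec d"
proof -
  obtain Y where u': "u' = u + complex_of_real h \<cdot>\<^sub>v vec_lincomb d (dim_vec (b1 G)) (\<lambda>j. b1 G $ j) (\<lambda>j. L *\<^sub>v Y j)
      + complex_of_real h \<cdot>\<^sub>v vec_lincomb d (dim_vec (b2 G)) (\<lambda>j. b2 G $ j) (\<lambda>j. g (t + c2 G $ j * h))"
    using assms unfolding gark_step_def Let_def by (elim exE conjE) (rule that)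
  show ?thesis by (rule carrier_vecI) (simp add: u' vec_lincomb_def)
qed

text \<open>
  A step of the scheme, read in the function model, has the form that \<open>scheme_step\<close> expects with
  operator \<open>h L\<close>.
\<close>

lemma gark_step_coords:
  fixes h :: real
  assumes G: "gark_stages G s1 s2" and L: "L \<in> carrier_mat d d" and u: "u \<in> carrier_vec d"
    and g: "\<And>j. j < s2 \<Longrightarrow> g (t + c2 G $ j * h) \<in> carrier_vec d"
    and step: "gark_step G d L g h t u u'"
  defines "T \<equiv> coord_op d (complex_of_real h \<cdot>\<^sub>m L)"
    and "f \<equiv> \<lambda>j. coord_scale (complex_of_real h) (coords d (g (t + c2 G $ j * h)))"
  obtains Y where "\<And>i. i < s1 \<Longrightarrow> Y i = coords d u
        + (\<Sum>j<s1. coord_scale (complex_of_real (A11 G $$ (i, j))) (T (Y j)))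
        + (\<Sum>j<s2. coord_scale (complex_of_real (A12 G $$ (i, j))) (f j))"
    and "coords d u' = coords d u
        + (\<Sum>j<s1. coord_scale (complex_of_real (b1 G $ j)) (T (Y j)))
        + (\<Sum>j<s2. coord_scale (complex_of_real (b2 G $ j)) (f j))"
proof -
  have dims: "dim_vec (b1 G) = s1" "dim_vec (b2 G) = s2"
    using gark_carriers[OF G] by auto
  obtain Y where Y: "\<And>i. i < s1 \<Longrightarrow> Y i \<in> carrier_vec d"
    and Y_eq: "\<And>i. i < s1 \<Longrightarrow> Y i = u + complex_of_real h \<cdot>\<^sub>v vec_lincomb d s1 (\<lambda>j. A11 G $$ (i, j)) (\<lambda>j. L *\<^sub>v Y j)
                     + complex_of_real h \<cdot>\<^sub>v vec_lincomb d s2 (\<lambda>j. A12 G $$ (i, j)) (\<lambda>j. g (t + c2 G $ j * h))"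
    and u'_eq: "u' = u + complex_of_real h \<cdot>\<^sub>v vec_lincomb d s1 (\<lambda>j. b1 G $ j) (\<lambda>j. L *\<^sub>v Y j)
                 + complex_of_real h \<cdot>\<^sub>v vec_lincomb d s2 (\<lambda>j. b2 G $ j) (\<lambda>j. g (t + c2 G $ j * h))"
    using step unfolding gark_step_def Let_def dims by blast
  have TY: "T (coords d (Y j)) r = complex_of_real h * (L *\<^sub>v Y j) $ r" if "j < s1" "r < d" for j r
    using that Y[OF that(1)] L
    by (simp add: T_def coord_op_coords smult_mult_mat_vec[of _ d d])
  have T0: "T v r = 0" if "\<not> r < d" for v r
    using that by (simp add: T_def coord_op_def)
  have combine: "coords d (u + complex_of_real h \<cdot>\<^sub>v vec_lincomb d s1 a1 (\<lambda>j. L *\<^sub>v Y j)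
        + complex_of_real h \<cdot>\<^sub>v vec_lincomb d s2 a2 (\<lambda>j. g (t + c2 G $ j * h)))
      = coords d u + (\<Sum>j<s1. coord_scale (complex_of_real (a1 j)) (T (coords d (Y j))))
        + (\<Sum>j<s2. coord_scale (complex_of_real (a2 j)) (f j))" for a1 a2
  proof (rule ext)
    fix r
    show "coords d (u + complex_of_real h \<cdot>\<^sub>v vec_lincomb d s1 a1 (\<lambda>j. L *\<^sub>v Y j)
        + complex_of_real h \<cdot>\<^sub>v vec_lincomb d s2 a2 (\<lambda>j. g (t + c2 G $ j * h))) r
      = (coords d u + (\<Sum>j<s1. coord_scale (complex_of_real (a1 j)) (T (coords d (Y j))))
        + (\<Sum>j<s2. coord_scale (complex_of_real (a2 j)) (f j))) r"
    proof (cases "r < d")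
      case True
      then show ?thesis using u
        by (simp add: coords_def[of d "_ + _"] sum_fun_apply coord_scale_def TY vec_lincomb_index f_def
            carrier_vecD[OF vec_lincomb_carrier] sum_distrib_left mult_ac)
           (simp add: coords_def)
    next
      case False
      then show ?thesis by (simp add: coords_def sum_fun_apply coord_scale_def T0 f_def)
    qed
  qed
  show thesis
  proof (rule that[of "\<lambda>i. coords d (Y i)"])
    show "coords d (Y i) = coords d u
        + (\<Sum>j<s1. coord_scale (complex_of_real (A11 G $$ (i, j))) (T (coords d (Y j))))
        + (\<Sum>j<s2. coord_scale (complex_of_real (A12 G $$ (i, j))) (f j))" if "i < s1" for i
      by (subst Y_eq[OF that]) (rule combine)
    show "coords d u' = coords d u
        + (\<Sum>j<s1. coord_scale (complex_of_real (b1 G $ j)) (T (coords d (Y j))))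
        + (\<Sum>j<s2. coord_scale (complex_of_real (b2 G $ j)) (f j))"
      by (subst u'_eq) (rule combine)
  qed
qed


theorem theorem4:
  fixes G :: gark and s1 s2 p :: nat and \<mu> \<tau> :: real
  assumes "gark_stages G s1 s2"
    and "\<mu> \<le> 0"
    and "A_stable (A11 G) (b1 G)"
    and "\<forall>k\<le>p. \<forall>l\<le>s1 + 1. w_coeff G k l = 0"
    and "W_tilde_bounded_on G (p + 1) {z. Re z \<le> \<mu>}"
  shows "\<exists>C>0. \<forall>(d::nat) (ip :: complex vec \<Rightarrow> complex vec \<Rightarrow> complex) (L :: complex mat)
           (g :: real \<Rightarrow> complex vec) (y :: real \<Rightarrow> complex vec) (u :: nat \<Rightarrow> complex vec)
           (t0::real) (tf::real) (h::real) (n::nat) (T :: real set).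
           inner_product d ip \<and>
           L \<in> carrier_mat d d \<and>
           (\<forall>v\<in>carrier_vec d. Re (ip v (L *\<^sub>v v)) \<le> \<mu> * (ip_norm ip v)\<^sup>2) \<and>
           0 < h \<and> tf = t0 + real n * h \<and> tf - t0 = \<tau> \<and>
           T = gark_interval G h t0 tf \<and>
           (\<forall>t\<in>T. g t \<in> carrier_vec d) \<and>
           vec_times_differentiable_on d p g T \<and>
           solves_linear_ode d L g y T \<and>
           gark_solvable G d L h \<and>
           gark_solution G d L g h t0 (y t0) n u
           \<longrightarrow> ereal (ip_norm ip (y tf - u n))
                 \<le> ereal C * (SUP t\<in>T. ereal (ip_norm ip (vec_nderiv_within d T (p + 1) y t)))
                     * ereal (h ^ p)"
proof -
  note G = assms(1) and stable = assms(3)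
  note c = gark_carriers[OF G]
  have order: "w_coeff G k l = 0" if "k \<le> p" "l \<le> s1 + 1" for k l
    using assms(4) that by blast
  have W: "W_tilde_bounded_on G (Suc p) {z. Re z \<le> \<mu>}" using assms(5) by simp
  have "\<exists>K0. \<forall>j\<in>{..<s2}. \<forall>z. Re z \<le> 0 \<longrightarrow>
      cmod (poly (smult (of_real (c2 G $ j ^ Suc p)) (pCons 0 (forcing_num G j))) z)
        \<le> K0 j * cmod (poly (pencil_det (A11 G)) z)"
    by (rule bchoice) (use forcing_num_bounds(1)[OF G stable W] in blast)
  then obtain K0 where K0: "\<And>j z. j < s2 \<Longrightarrow> Re z \<le> 0 \<Longrightarrow>
      cmod (poly (smult (of_real (c2 G $ j ^ Suc p)) (pCons 0 (forcing_num G j))) z)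
        \<le> K0 j * cmod (poly (pencil_det (A11 G)) z)" by blast
  have "\<exists>K1. \<forall>j\<in>{..<s2}. \<forall>z. Re z \<le> 0 \<longrightarrow>
      cmod (poly (smult (of_real (c2 G $ j ^ p)) (forcing_num G j)) z)
        \<le> K1 j * cmod (poly (pencil_det (A11 G)) z)"
    by (rule bchoice) (use forcing_num_bounds(2)[OF G stable W] in blast)
  then obtain K1 where K1: "\<And>j z. j < s2 \<Longrightarrow> Re z \<le> 0 \<Longrightarrow>
      cmod (poly (smult (of_real (c2 G $ j ^ p)) (forcing_num G j)) z)
        \<le> K1 j * cmod (poly (pencil_det (A11 G)) z)" by blast
  define C0 where "C0 = 1 + (\<Sum>j<s2. \<bar>K0 j\<bar> + \<bar>K1 j\<bar>)"
  have C0: "0 < C0" by (simp add: C0_def add_pos_nonneg sum_nonneg)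
  \<comment> \<open>the summand 1 keeps the constant positive also for \<open>\<tau> = 0\<close>\<close>
  define C where "C = \<bar>\<tau>\<bar> * C0 + 1"
  have C: "0 < C" using C0 by (simp add: C_def add_nonneg_pos)
  show ?thesis
  proof (intro exI[of _ C] conjI C allI impI, elim conjE)
    fix d :: nat and ip :: "complex vec \<Rightarrow> complex vec \<Rightarrow> complex" and L :: "complex mat"
      and g y :: "real \<Rightarrow> complex vec" and u :: "nat \<Rightarrow> complex vec" and t0 tf h :: real and n :: nat
      and T :: "real set"
    assume ip: "inner_product d ip" and L: "L \<in> carrier_mat d d"
      and dissip: "\<forall>v\<in>carrier_vec d. Re (ip v (L *\<^sub>v v)) \<le> \<mu> * (ip_norm ip v)\<^sup>2"
      and h: "0 < h" and tf: "tf = t0 + real n * h" and \<tau>: "tf - t0 = \<tau>"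
      and T: "T = gark_interval G h t0 tf" and g: "\<forall>t\<in>T. g t \<in> carrier_vec d"
      and gd: "vec_times_differentiable_on d p g T" and ode: "solves_linear_ode d L g y T"
      and sol: "gark_solution G d L g h t0 (y t0) n u"
    define Z where "Z = complex_of_real h \<cdot>\<^sub>m L"
    have Z: "Z \<in> carrier_mat d d" using L by (simp add: Z_def)
    have Zd: "Re (ip v (Z *\<^sub>v v)) \<le> 0" if v: "v \<in> carrier_vec d" for v
    proof -
      have "Re (ip v (L *\<^sub>v v)) \<le> \<mu> * (ip_norm ip v)\<^sup>2" using dissip v by blast
      also have "\<dots> \<le> 0" using assms(2) by (simp add: mult_nonpos_nonneg)
      finally have "h * Re (ip v (L *\<^sub>v v)) \<le> 0" using h by (simp add: mult_nonneg_nonpos)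
      moreover have "L *\<^sub>v v \<in> carrier_vec d" by (rule mult_mat_vec_carrier[OF L v])
      ultimately show ?thesis
        using inner_productD(2)[OF ip v, of "L *\<^sub>v v" "complex_of_real h"] L v
        by (simp add: Z_def smult_mult_mat_vec[of _ d d])
    qed
    interpret dissipative_operator coord_scale "coord_form d ip" "coord_op d Z"
      by (rule coord_dissipative_operator[OF ip Z Zd])
    have nrm_eq: "nrm v = ip_norm ip (vec d v)" for v by (simp add: nrm_def ip_norm_def coord_form_def)
    define lo where "lo = Min (insert 0 (set\<^sub>v (c2 G)))"
    define hi where "hi = Max (insert 0 ((\<lambda>c. c - 1) ` set\<^sub>v (c2 G)))"
    define a where "a = t0 + lo * h"
    define b where "b = tf + hi * h"
    have T_ab: "T = {a..b}" by (simp add: T gark_interval_def a_def b_def lo_def hi_def)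
    have fin: "finite (set\<^sub>v (c2 G))" by (simp add: vec_set_def)
    have lo: "lo \<le> 0" "\<And>j. j < s2 \<Longrightarrow> lo \<le> c2 G $ j"
      and hi: "0 \<le> hi" "\<And>j. j < s2 \<Longrightarrow> c2 G $ j - 1 \<le> hi"
      unfolding lo_def hi_def using fin c(5) by (auto intro!: Min_le Max_ge vec_setI)
    have node: "t0 + x * h \<in> T" if "lo \<le> x" "x \<le> real n + hi" for x
      using mult_right_mono[OF that(1), of h] mult_right_mono[OF that(2), of h] h
      by (simp add: T_ab a_def b_def tf algebra_simps)
    have t0: "t0 \<in> T" using node[of 0] lo hi by simp
    have yc: "y t \<in> carrier_vec d" if "t \<in> T" for t
      using ode that by (simp add: solves_linear_ode_def)
    define S where "S = (SUP t\<in>T. ereal (ip_norm ip (vec_nderiv_within d T (p + 1) y t)))"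
    have S_upper: "ereal (ip_norm ip (vec_nderiv_within d T (p + 1) y t)) \<le> S" if "t \<in> T" for t
      unfolding S_def by (rule SUP_upper[OF that])
    have nonneg: "0 \<le> ip_norm ip (vec_nderiv_within d T (p + 1) y t)" for t
      unfolding ip_norm_def
      by (intro real_sqrt_ge_zero inner_product_nonneg[OF ip]) (simp add: vec_nderiv_within_def)
    have S0: "0 \<le> S" using S_upper[OF t0] nonneg[of t0] by (meson ereal_less_eq(5) order_trans)
    have "ereal (ip_norm ip (y tf - u n)) \<le> ereal C * S * ereal (h ^ p)"
    proof (cases "S = \<infinity>")
      case True
      then show ?thesis using C h by simp
    next
      case False
      then obtain M where M: "S = ereal M" using S0 by (cases S) auto
      have M0: "0 \<le> M" using S0 M by simp
      have u0: "u 0 = y t0" and step: "\<And>m. m < n \<Longrightarrow> gark_step G d L g h (t0 + real m * h) (u m) (u (Suc m))"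
        using sol by (auto simp: gark_solution_def)
      have uc: "u m \<in> carrier_vec d" if "m \<le> n" for m
        using that u0 yc[OF t0] gark_step_carrier[OF step] by (cases m) auto
      define Y where "Y = (\<lambda>k t i. if i < d then nderiv_within T k (\<lambda>u. y u $ i) t else 0)"
      have Y0: "Y 0 t = coords d (y t)" for t by (simp add: Y_def coords_def fun_eq_iff)
      define err where "err = (\<lambda>m. nrm (Y 0 (t0 + real m * h) - coords d (u m)))"
      have err: "err m \<le> real m * (C0 * (h ^ Suc p * M))" if "m \<le> n" for m
        using that
      proof (induction m)
        case 0
        show ?case
          by (simp only: err_def Y0 u0 of_nat_0 mult_zero_left add_0_right diff_self nrm_0 order_refl)
      next
        case (Suc m)
        let ?t = "t0 + real m * h"
        have m: "m < n" using Suc.prems by simp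
        have ab: "a < b"
        proof -
          have "lo * h \<le> 0" "0 \<le> hi * h" "0 < real n * h" using lo hi h m by (auto simp: mult_nonpos_nonneg)
          then show ?thesis by (simp add: a_def b_def tf)
        qed
        note der = ode_derivatives[OF ab L ode[unfolded T_ab] g[unfolded T_ab]
            gd[unfolded T_ab], folded T_ab]
        have tn: "?t \<in> T" using node[of "real m"] lo hi m by simp
        have tc: "?t + c2 G $ j * h \<in> T" if "j < s2" for j
        proof -
          have "t0 + (real m + c2 G $ j) * h \<in> T"
            using lo(2)[OF that] hi(2)[OF that] m by (intro node) auto
          then show ?thesis by (simp add: algebra_simps)
        qed
        have th: "?t + h \<in> T"
        proof -
          have "t0 + (real m + 1) * h \<in> T" using lo hi m by (intro node) auto
          then show ?thesis by (simp add: algebra_simps)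
        qed
        define f where "f = (\<lambda>j. coord_scale (complex_of_real h) (coords d (g (?t + c2 G $ j * h))))"
        have f: "f j = coord_scale (complex_of_real h) (Y 1 (?t + c2 G $ j * h)) - coord_op d Z (Y 0 (?t + c2 G $ j * h))"
          if j: "j < s2" for j
        proof (rule ext)
          fix i
          let ?s = "?t + c2 G $ j * h"
          show "f j i = (coord_scale (complex_of_real h) (Y 1 ?s) - coord_op d Z (Y 0 ?s)) i"
          proof (cases "i < d")
            case True
            have "Y 1 ?s i = (\<Sum>k<d. L $$ (i, k) * y ?s $ k) + g ?s $ i"
              using der(2)[OF le0 True tc[OF j]] True by (simp add: Y_def)
            moreover have "coord_op d Z (Y 0 ?s) i = complex_of_real h * (\<Sum>k<d. L $$ (i, k) * y ?s $ k)"
            proof -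
              have "coord_op d Z (Y 0 ?s) i = complex_of_real h * (L *\<^sub>v y ?s) $ i"
                unfolding Y0 coord_op_coords[OF yc[OF tc[OF j]]] Z_def
                using True L yc[OF tc[OF j]] by (simp add: smult_mult_mat_vec[of _ d d])
              also have "(L *\<^sub>v y ?s) $ i = (\<Sum>k<d. L $$ (i, k) * y ?s $ k)"
                using True L yc[OF tc[OF j]] by (auto simp: scalar_prod_def atLeast0LessThan intro!: sum.cong)
              finally show ?thesis .
            qed
            ultimately show ?thesis using True by (simp add: f_def coord_scale_def coords_def algebra_simps)
          next
            case False
            then show ?thesis by (simp add: f_def coord_scale_def coords_def coord_op_def Y_def)
          qed
        qed
        obtain X where X: "\<And>i. i < s1 \<Longrightarrow> X i = coords d (u m)
              + (\<Sum>j<s1. coord_scale (complex_of_real (A11 G $$ (i, j))) (coord_op d Z (X j)))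
              + (\<Sum>j<s2. coord_scale (complex_of_real (A12 G $$ (i, j))) (f j))"
          and u_next: "coords d (u (Suc m)) = coords d (u m)
              + (\<Sum>j<s1. coord_scale (complex_of_real (b1 G $ j)) (coord_op d Z (X j)))
              + (\<Sum>j<s2. coord_scale (complex_of_real (b2 G $ j)) (f j))"
          using gark_step_coords[OF G L uc[of m] _ step[OF m]] g tc m unfolding f_def Z_def by auto
        have th': "t0 + real (Suc m) * h = ?t + h" by (simp add: algebra_simps)
        have "err (Suc m) \<le> err m + C0 * (h ^ Suc p * M)"
          unfolding C0_def err_def th'
        proof (rule smooth_step_error[where S = T and f = f])
          show "convex T" by (simp add: T_ab)
          show "((\<lambda>s. Re (coord_form d ip v (Y k s))) has_field_derivative Re (coord_form d ip v (Y (Suc k) t)))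
              (at t within T)" if "k \<le> p" "t \<in> T" for v k t
            using der(1)[OF that(1) _ that(2)] by (intro coord_form_has_derivative[OF ip]) (simp add: Y_def)
          show "nrm (Y (Suc p) t) \<le> M" if "t \<in> T" for t
          proof -
            have "vec d (Y (Suc p) t) = vec_nderiv_within d T (p + 1) y t"
              by (intro eq_vecI) (auto simp: Y_def vec_nderiv_within_def)
            then show ?thesis using S_upper[OF that] by (simp add: nrm_eq M)
          qed
          show "op (pencil_det (A11 G)) (coords d (u (Suc m)))
              = op (stability_num G) (coords d (u m)) + (\<Sum>j<s2. op (forcing_num G j) (f j))"
            by (rule scheme_step[OF G X u_next])
        qed (fact G stable order K0 K1 tn th tc h f)+
        also have "\<dots> \<le> real m * (C0 * (h ^ Suc p * M)) + C0 * (h ^ Suc p * M)"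
          by (rule add_right_mono[OF Suc.IH]) (use m in simp)
        finally show ?case by (simp add: algebra_simps)
      qed
      have \<tau>C: "\<tau> * C0 \<le> C"
      proof -
        have "\<tau> * C0 \<le> \<bar>\<tau>\<bar> * C0" using C0 by (intro mult_right_mono abs_ge_self) simp
        then show ?thesis by (simp add: C_def)
      qed
      have "ip_norm ip (y tf - u n) \<le> real n * (C0 * (h ^ Suc p * M))"
      proof -
        have "tf \<in> T" using node[of "real n"] lo hi by (simp add: tf)
        then have "vec d (coords d (y tf) - coords d (u n)) = y tf - u n"
          using yc uc[of n] by (intro eq_vecI) (auto simp: coords_def)
        then have "err n = ip_norm ip (y tf - u n)" by (simp only: err_def nrm_eq Y0 tf)
        then show ?thesis using err[of n] by simp
      qed
      also have "\<dots> = (\<tau> * C0) * M * h ^ p" using tf \<tau> by (auto simp: algebra_simps)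
      also have "\<dots> \<le> C * M * h ^ p"
        by (intro mult_right_mono \<tau>C) (use M0 h in simp_all)
      finally show ?thesis by (simp add: M)
    qed
    then show "ereal (ip_norm ip (y tf - u n))
        \<le> ereal C * (SUP t\<in>T. ereal (ip_norm ip (vec_nderiv_within d T (p + 1) y t))) * ereal (h ^ p)"
      by (simp add: S_def)
  qed
qed

end
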